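(* Let $\nu_0,\mu_0$ be arbitrary. Consider the representation of the universal enveloping algebra of any of the real Lie algebras $\mathfrak{so}(3,2)$, $\mathfrak{so}(4,1)$, $\mathfrak{so}(5,\mathbb{R})$ (realized, with their tensor operators $({\bf M}_{ab})$ and diagonal matrices $\Gamma$, as in the context) on the span of the generalized solid harmonics $$\mathcal{S}_{\nu_0+n}^{\mu_0+m}(r,\theta,\varphi),\qquad(n,m)\in\mathbb{Z}^2,\qquad \mathcal{S}_\nu^\mu(r,\theta,\varphi):=r^\nu\,{\rm P}_\nu^\mu(\cos\theta)\,{\rm e}^{{\rm i}\mu\varphi}.$$ Then the quadratic and quartic Casimirs $$c_2:=-\tfrac12{\bf M}_{ab}{\bf M}^{ab},\qquad c_4:=-w_aw^a,\qquad w^a:=\tfrac18\epsilon^{abcde}{\bf M}_{bc}{\bf M}_{de},$$ are represented by the constants $-\frac54$ and $0$ respectively, irrespective of $\nu_0,\mu_0$.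
   Context: ${\rm P}_\nu^\mu(z)=\frac1{\Gamma(1-\mu)}\left(\frac{1+z}{1-z}\right)^{\mu/2}{}_2F_1\!\left(-\nu,\nu+1;1-\mu;\frac{1-z}2\right)$, $z\in(-1,1)$, is the Ferrers function of the first kind (a limit being taken if $\mu$ is a positive integer). On functions of $r>0$, $\theta\in(0,\pi)$, $\varphi\in\mathbb{R}$, define $$J_\pm={\rm e}^{\pm{\rm i}\varphi}\left[\pm D_\theta+{\rm i}(\cot\theta)D_\varphi\right],\quad K_\pm=r^{\pm1}\left[\pm(\sin\theta)D_\theta+(\cos\theta)(rD_r+\tfrac12\pm\tfrac12)\right],$$ $$R_\pm=r^{\pm1}{\rm e}^{\pm{\rm i}\varphi}\left[\pm(\cos\theta)D_\theta+{\rm i}(\csc\theta)D_\varphi-(\sin\theta)(rD_r+\tfrac12\pm\tfrac12)\right],$$ $$S_\pm=r^{\pm1}{\rm e}^{\mp{\rm i}\varphi}\left[\mp(\cos\theta)D_\theta+{\rm i}(\csc\theta)D_\varphi+(\sin\theta)(rD_r+\tfrac12\pm\tfrac12)\right],$$ $$J_3=-{\rm i}D_\varphi,\qquad K_3=rD_r+\tfrac12.$$ They act on the solid harmonics by (with $[a,b]_\pm$ meaning $a$ in the $+$ case, $b$ in the $-$ case) $$J_\pm\mathcal{S}_\nu^\mu=[1,(\nu+\mu)(\nu-\mu+1)]_\pm\mathcal{S}_\nu^{\mu\pm1},\quad K_\pm\mathcal{S}_\nu^\mu=[\nu-\mu+1,\nu+\mu]_\pm\mathcal{S}_{\nu\pm1}^\mu,$$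 $$R_\pm\mathcal{S}_\nu^\mu=[1,(\nu+\mu)(\nu+\mu-1)]_\pm\mathcal{S}_{\nu\pm1}^{\mu\pm1},\quad S_\pm\mathcal{S}_\nu^\mu=[(\nu-\mu+1)(\nu-\mu+2),1]_\pm\mathcal{S}_{\nu\pm1}^{\mu\mp1},$$ $$J_3\mathcal{S}_\nu^\mu=\mu\mathcal{S}_\nu^\mu,\quad K_3\mathcal{S}_\nu^\mu=(\nu+\tfrac12)\mathcal{S}_\nu^\mu,$$ which specifies the representation (equivalently, by infinite matrices indexed by $(n,m)\in\mathbb{Z}^2$). Put $J_1=\frac12(J_++J_-)$, $J_2=-\frac{\rm i}2(J_+-J_-)$, $D=K_3$, and $$PC_1^\pm=\tfrac14(\mp R_+-R_-\pm S_++S_-),\quad PC_2^\pm=-\tfrac{\rm i}4(\mp R_++R_-\mp S_++S_-),\quad PC_3^\pm=\tfrac12(\pm K_++K_-).$$ The real Lie algebras are the real spans of the entries of the following skew-symmetric $5\times5$ arrays (${\bf M}_{ba}=-{\bf M}_{ab}$), whose entries satisfy $[{\bf M}_{ab},{\bf M}_{cd}]=g_{ad}{\bf M}_{bc}+g_{bc}{\bf M}_{ad}-g_{ac}{\bf M}_{bd}-g_{bd}{\bf M}_{ac}$ with $\Gamma=(g_{ab})$ as given: (A) $\mathfrak{so}(3,2)$, $\Gamma={\rm diag}(1,1,-1,-1,-1)$: ${\bf M}_{12}={\rm i}PC_2^-$, ${\bf M}_{13}=-PC_1^-$, ${\bf M}_{14}=-PC_3^-$, ${\bf M}_{15}=-D$,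 ${\bf M}_{23}=J_3$, ${\bf M}_{24}=-J_1$, ${\bf M}_{25}={\rm i}PC_2^+$, ${\bf M}_{34}={\rm i}J_2$, ${\bf M}_{35}=-PC_1^+$, ${\bf M}_{45}=-PC_3^+$. (B) $\mathfrak{so}(4,1)$, $\Gamma={\rm diag}(1,-1,-1,-1,-1)$: ${\bf M}_{1,i+1}=-PC_i^-$ and ${\bf M}_{i+1,5}=-PC_i^+$ for $i=1,2,3$, ${\bf M}_{15}=-D$, ${\bf M}_{23}=-{\rm i}J_3$, ${\bf M}_{24}={\rm i}J_2$, ${\bf M}_{34}=-{\rm i}J_1$. (C) $\mathfrak{so}(3,2)$ (second realization), $\Gamma={\rm diag}(1,-1,-1,-1,1)$: as in (B), except ${\bf M}_{i+1,5}=-{\rm i}PC_i^+$ and ${\bf M}_{15}=-{\rm i}D$. (D) $\mathfrak{so}(5,\mathbb{R})$, $\Gamma={\rm diag}(-1,-1,-1,-1,-1)$: as in (B), except ${\bf M}_{1,i+1}=-{\rm i}PC_i^-$ and ${\bf M}_{15}=-{\rm i}D$. In $c_2,c_4,w^a$ the summation convention is used; indices are raised and lowered by $\Gamma^{-1}=(g^{ab})$ and $\Gamma=(g_{ab})$; $\epsilon_{abcde}$ is totally skew-symmetric with $\epsilon_{12345}=+1$. *)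

theory Defs
  imports "HOL-Analysis.Analysis" "HOL-Library.Function_Algebras"
begin

subsection \<open>Generalized solid harmonics\<close>

definition hyp2F1 :: "complex \<Rightarrow> complex \<Rightarrow> complex \<Rightarrow> complex \<Rightarrow> complex" where
  "hyp2F1 a b c z = eval_fps (fps_hypergeo [a, b] [c] 1) z"

definition ferrersP_generic :: "complex \<Rightarrow> complex \<Rightarrow> real \<Rightarrow> complex" where
  "ferrersP_generic \<nu> \<mu> z =
     1 / Gamma (1 - \<mu>) * complex_of_real ((1 + z) / (1 - z)) powr (\<mu> / 2)
       * hyp2F1 (- \<nu>) (\<nu> + 1) (1 - \<mu>) (complex_of_real ((1 - z) / 2))"

definition ferrersP :: "complex \<Rightarrow> complex \<Rightarrow> real \<Rightarrow> complex" where
  "ferrersP \<nu> \<mu> z =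
     (if \<exists>k::nat. 1 \<le> k \<and> \<mu> = of_nat k
      then Lim (at \<mu>) (\<lambda>\<mu>'. ferrersP_generic \<nu> \<mu>' z)
      else ferrersP_generic \<nu> \<mu> z)"

text \<open>A point is a triple (r, theta, phi). Functions on the domain below are represented by
  total functions; their values outside it are irrelevant, and since the domain is open they
  do not influence derivatives inside it.\<close>

type_synonym point = "real \<times> real \<times> real"

definition solid_domain :: "point set" where
  "solid_domain = {0<..} \<times> {0<..<pi} \<times> UNIV"

definition solid_harmonic :: "complex \<Rightarrow> complex \<Rightarrow> point \<Rightarrow> complex" where
  "solid_harmonic \<nu> \<mu> = (\<lambda>(r, \<theta>, \<phi>).
     complex_of_real r powr \<nu> * ferrersP \<nu> \<mu> (cos \<theta>) * exp (\<i> * \<mu> * complex_of_real \<phi>))"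

definition harmonic_span :: "complex \<Rightarrow> complex \<Rightarrow> (point \<Rightarrow> complex) set" where
  "harmonic_span \<nu>0 \<mu>0 = module.span (\<lambda>(c::complex) f p. c * f p)
     (range (\<lambda>(n::int, m::int). solid_harmonic (\<nu>0 + of_int n) (\<mu>0 + of_int m)))"

subsection \<open>Operators\<close>

text \<open>Operators act on functions from \<open>'x\<close> to the complex numbers; their sums, differences, and
  negatives are the pointwise ones for functions, and their product is composition.\<close>

type_synonym 'x op = "('x \<Rightarrow> complex) \<Rightarrow> ('x \<Rightarrow> complex)"

definition scale_op :: "complex \<Rightarrow> 'x op \<Rightarrow> 'x op"  (infixr "*\<^sub>o" 75) where
  "c *\<^sub>o A = (\<lambda>f x. c * A f x)"

datatype pm = Plus | Minus

primrec pm_sign :: "pm \<Rightarrow> int" where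
  "pm_sign Plus = 1"
| "pm_sign Minus = - 1"

datatype generator = Jpm pm | Kpm pm | Rpm pm | Spm pm | J3 | K3

definition D_r :: "point op" where
  "D_r f = (\<lambda>(r, \<theta>, \<phi>). vector_derivative (\<lambda>s. f (s, \<theta>, \<phi>)) (at r))"

definition D_theta :: "point op" where
  "D_theta f = (\<lambda>(r, \<theta>, \<phi>). vector_derivative (\<lambda>s. f (r, s, \<phi>)) (at \<theta>))"

definition D_phi :: "point op" where
  "D_phi f = (\<lambda>(r, \<theta>, \<phi>). vector_derivative (\<lambda>s. f (r, \<theta>, s)) (at \<phi>))"

definition euler_op :: "pm \<Rightarrow> point op" where
  \<comment> \<open>The operator r D_r + 1/2 +/- 1/2.\<close>
  "euler_op s f = (\<lambda>(r, \<theta>, \<phi>).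
     complex_of_real r * D_r f (r, \<theta>, \<phi>) + (1/2 + of_int (pm_sign s) / 2) * f (r, \<theta>, \<phi>))"

primrec diff_op :: "generator \<Rightarrow> point op" where
  "diff_op (Jpm s) = (\<lambda>f (r, \<theta>, \<phi>).
     cis (of_int (pm_sign s) * \<phi>) *
       (of_int (pm_sign s) * D_theta f (r, \<theta>, \<phi>)
        + \<i> * complex_of_real (cot \<theta>) * D_phi f (r, \<theta>, \<phi>)))"
| "diff_op (Kpm s) = (\<lambda>f (r, \<theta>, \<phi>).
     complex_of_real (r powi pm_sign s) *
       (of_int (pm_sign s) * complex_of_real (sin \<theta>) * D_theta f (r, \<theta>, \<phi>)
        + complex_of_real (cos \<theta>) * euler_op s f (r, \<theta>, \<phi>)))"
| "diff_op (Rpm s) = (\<lambda>f (r, \<theta>, \<phi>).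
     complex_of_real (r powi pm_sign s) * cis (of_int (pm_sign s) * \<phi>) *
       (of_int (pm_sign s) * complex_of_real (cos \<theta>) * D_theta f (r, \<theta>, \<phi>)
        + \<i> * complex_of_real (1 / sin \<theta>) * D_phi f (r, \<theta>, \<phi>)
        - complex_of_real (sin \<theta>) * euler_op s f (r, \<theta>, \<phi>)))"
| "diff_op (Spm s) = (\<lambda>f (r, \<theta>, \<phi>).
     complex_of_real (r powi pm_sign s) * cis (- of_int (pm_sign s) * \<phi>) *
       (- of_int (pm_sign s) * complex_of_real (cos \<theta>) * D_theta f (r, \<theta>, \<phi>)
        + \<i> * complex_of_real (1 / sin \<theta>) * D_phi f (r, \<theta>, \<phi>)
        + complex_of_real (sin \<theta>) * euler_op s f (r, \<theta>, \<phi>)))"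
| "diff_op J3 = (\<lambda>f p. - \<i> * D_phi f p)"
| "diff_op K3 = (\<lambda>f (r, \<theta>, \<phi>).
     complex_of_real r * D_r f (r, \<theta>, \<phi>) + 1/2 * f (r, \<theta>, \<phi>))"

text \<open>The infinite matrices of the representation: a generator sends the basis vector with
  index (n, m) to \<open>ladder_coeff\<close>, taken at degree \<open>\<nu>0 + n\<close> and order \<open>\<mu>0 + m\<close>, times the basis
  vector with index (n, m) + \<open>shift\<close>. \<open>matrix_op\<close> is the resulting action on coefficient vectors.\<close>

primrec shift :: "generator \<Rightarrow> int \<times> int" where
  "shift (Jpm s) = (0, pm_sign s)"
| "shift (Kpm s) = (pm_sign s, 0)"
| "shift (Rpm s) = (pm_sign s, pm_sign s)"
| "shift (Spm s) = (pm_sign s, - pm_sign s)"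
| "shift J3 = (0, 0)"
| "shift K3 = (0, 0)"

primrec ladder_coeff :: "generator \<Rightarrow> complex \<Rightarrow> complex \<Rightarrow> complex" where
  "ladder_coeff (Jpm s) \<nu> \<mu> = (case s of Plus \<Rightarrow> 1 | Minus \<Rightarrow> (\<nu> + \<mu>) * (\<nu> - \<mu> + 1))"
| "ladder_coeff (Kpm s) \<nu> \<mu> = (case s of Plus \<Rightarrow> \<nu> - \<mu> + 1 | Minus \<Rightarrow> \<nu> + \<mu>)"
| "ladder_coeff (Rpm s) \<nu> \<mu> = (case s of Plus \<Rightarrow> 1 | Minus \<Rightarrow> (\<nu> + \<mu>) * (\<nu> + \<mu> - 1))"
| "ladder_coeff (Spm s) \<nu> \<mu> = (case s of Plus \<Rightarrow> (\<nu> - \<mu> + 1) * (\<nu> - \<mu> + 2) | Minus \<Rightarrow> 1)"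
| "ladder_coeff J3 \<nu> \<mu> = \<mu>"
| "ladder_coeff K3 \<nu> \<mu> = \<nu> + 1/2"

definition matrix_op :: "complex \<Rightarrow> complex \<Rightarrow> generator \<Rightarrow> (int \<times> int) op" where
  "matrix_op \<nu>0 \<mu>0 X v = (\<lambda>(n, m). let n' = n - fst (shift X); m' = m - snd (shift X) in
     ladder_coeff X (\<nu>0 + of_int n') (\<mu>0 + of_int m') * v (n', m'))"

subsection \<open>The tensor operators\<close>

text \<open>From here on \<open>\<rho>\<close> assigns an operator to each generator.\<close>

definition J1 :: "(generator \<Rightarrow> 'x op) \<Rightarrow> 'x op" where
  "J1 \<rho> = (1/2) *\<^sub>o (\<rho> (Jpm Plus) + \<rho> (Jpm Minus))"

definition J2 :: "(generator \<Rightarrow> 'x op) \<Rightarrow> 'x op" where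
  "J2 \<rho> = (- \<i>/2) *\<^sub>o (\<rho> (Jpm Plus) - \<rho> (Jpm Minus))"

definition PC1 :: "(generator \<Rightarrow> 'x op) \<Rightarrow> pm \<Rightarrow> 'x op" where
  "PC1 \<rho> s = (let \<sigma> = of_int (pm_sign s) in
     (1/4) *\<^sub>o ((- \<sigma>) *\<^sub>o \<rho> (Rpm Plus) - \<rho> (Rpm Minus) + \<sigma> *\<^sub>o \<rho> (Spm Plus) + \<rho> (Spm Minus)))"

definition PC2 :: "(generator \<Rightarrow> 'x op) \<Rightarrow> pm \<Rightarrow> 'x op" where
  "PC2 \<rho> s = (let \<sigma> = of_int (pm_sign s) in
     (- \<i>/4) *\<^sub>o ((- \<sigma>) *\<^sub>o \<rho> (Rpm Plus) + \<rho> (Rpm Minus) - \<sigma> *\<^sub>o \<rho> (Spm Plus) + \<rho> (Spm Minus)))"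

definition PC3 :: "(generator \<Rightarrow> 'x op) \<Rightarrow> pm \<Rightarrow> 'x op" where
  "PC3 \<rho> s = (1/2) *\<^sub>o (of_int (pm_sign s) *\<^sub>o \<rho> (Kpm Plus) + \<rho> (Kpm Minus))"

datatype realization =
    SO32    \<comment> \<open>so(3,2) with Gamma = diag(1,1,-1,-1,-1)\<close>
  | SO41    \<comment> \<open>so(4,1) with Gamma = diag(1,-1,-1,-1,-1)\<close>
  | SO32'   \<comment> \<open>so(3,2) with Gamma = diag(1,-1,-1,-1,1)\<close>
  | SO5     \<comment> \<open>so(5,R) with Gamma = diag(-1,-1,-1,-1,-1)\<close>

primrec metric_diag :: "realization \<Rightarrow> complex list" where
  "metric_diag SO32  = [ 1,  1, -1, -1, -1]"
| "metric_diag SO41  = [ 1, -1, -1, -1, -1]"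
| "metric_diag SO32' = [ 1, -1, -1, -1,  1]"
| "metric_diag SO5   = [-1, -1, -1, -1, -1]"

text \<open>Tensor indices run over \<open>{1..5}\<close>, list positions start at 0.\<close>

definition metric :: "realization \<Rightarrow> nat \<Rightarrow> nat \<Rightarrow> complex" where
  "metric L a b = (if a = b then metric_diag L ! (a - 1) else 0)"

definition inv_metric :: "realization \<Rightarrow> nat \<Rightarrow> nat \<Rightarrow> complex" where
  "inv_metric L a b = (if a = b then 1 / metric_diag L ! (a - 1) else 0)"

text \<open>The strictly upper triangular part, row by row: (12, 13, 14, 15), (23, 24, 25),
  (34, 35), (45).\<close>

primrec M_rows :: "realization \<Rightarrow> (generator \<Rightarrow> 'x op) \<Rightarrow> 'x op list list" where
  "M_rows SO32 \<rho> =
     [[\<i> *\<^sub>o PC2 \<rho> Minus, - PC1 \<rho> Minus, - PC3 \<rho> Minus, - \<rho> K3],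
      [\<rho> J3, - J1 \<rho>, \<i> *\<^sub>o PC2 \<rho> Plus],
      [\<i> *\<^sub>o J2 \<rho>, - PC1 \<rho> Plus],
      [- PC3 \<rho> Plus]]"
| "M_rows SO41 \<rho> =
     [[- PC1 \<rho> Minus, - PC2 \<rho> Minus, - PC3 \<rho> Minus, - \<rho> K3],
      [(- \<i>) *\<^sub>o \<rho> J3, \<i> *\<^sub>o J2 \<rho>, - PC1 \<rho> Plus],
      [(- \<i>) *\<^sub>o J1 \<rho>, - PC2 \<rho> Plus],
      [- PC3 \<rho> Plus]]"
| "M_rows SO32' \<rho> =
     [[- PC1 \<rho> Minus, - PC2 \<rho> Minus, - PC3 \<rho> Minus, (- \<i>) *\<^sub>o \<rho> K3],
      [(- \<i>) *\<^sub>o \<rho> J3, \<i> *\<^sub>o J2 \<rho>, (- \<i>) *\<^sub>o PC1 \<rho> Plus],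
      [(- \<i>) *\<^sub>o J1 \<rho>, (- \<i>) *\<^sub>o PC2 \<rho> Plus],
      [(- \<i>) *\<^sub>o PC3 \<rho> Plus]]"
| "M_rows SO5 \<rho> =
     [[(- \<i>) *\<^sub>o PC1 \<rho> Minus, (- \<i>) *\<^sub>o PC2 \<rho> Minus, (- \<i>) *\<^sub>o PC3 \<rho> Minus, (- \<i>) *\<^sub>o \<rho> K3],
      [(- \<i>) *\<^sub>o \<rho> J3, \<i> *\<^sub>o J2 \<rho>, - PC1 \<rho> Plus],
      [(- \<i>) *\<^sub>o J1 \<rho>, - PC2 \<rho> Plus],
      [- PC3 \<rho> Plus]]"

definition M :: "realization \<Rightarrow> (generator \<Rightarrow> 'x op) \<Rightarrow> nat \<Rightarrow> nat \<Rightarrow> 'x op" where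
  "M L \<rho> a b =
     (if a < b then M_rows L \<rho> ! (a - 1) ! (b - a - 1)
      else if b < a then - (M_rows L \<rho> ! (b - 1) ! (a - b - 1))
      else 0)"

definition M_up :: "realization \<Rightarrow> (generator \<Rightarrow> 'x op) \<Rightarrow> nat \<Rightarrow> nat \<Rightarrow> 'x op" where
  "M_up L \<rho> a b =
     (\<Sum>c\<in>{1..5}. \<Sum>d\<in>{1..5}. (inv_metric L a c * inv_metric L b d) *\<^sub>o M L \<rho> c d)"

subsection \<open>Casimir operators\<close>

text \<open>The Levi-Civita symbol as the product of the signs of all pairwise index differences.\<close>

definition levi_civita :: "nat \<Rightarrow> nat \<Rightarrow> nat \<Rightarrow> nat \<Rightarrow> nat \<Rightarrow> complex" where
  "levi_civita a b c d e = (let i = map int [a, b, c, d, e] in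
     of_int (\<Prod>q<5. \<Prod>p<q. sgn (i ! q - i ! p)))"

lemma levi_civita_expand:
  "levi_civita a b c d e = of_int
     (sgn (int b - int a) * sgn (int c - int a) * sgn (int d - int a) * sgn (int e - int a) *
      sgn (int c - int b) * sgn (int d - int b) * sgn (int e - int b) *
      sgn (int d - int c) * sgn (int e - int c) * sgn (int e - int d))"
  by (simp add: levi_civita_def Let_def eval_nat_numeral lessThan_Suc mult_ac)

lemma levi_civita_12345: "levi_civita 1 2 3 4 5 = 1"
  by (simp add: levi_civita_expand)

lemma sgn_diff_swap: "sgn (int x - int y) = - sgn (int y - int x)"
  by (simp add: sgn_if)

lemma levi_civita_skew:
  "levi_civita b a c d e = - levi_civita a b c d e"
  "levi_civita a c b d e = - levi_civita a b c d e"
  "levi_civita a b d c e = - levi_civita a b c d e"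
  "levi_civita a b c e d = - levi_civita a b c d e"
  unfolding levi_civita_expand
  by (subst sgn_diff_swap[of a b] sgn_diff_swap[of b c] sgn_diff_swap[of c d] sgn_diff_swap[of d e],
      simp add: mult_ac)+

definition levi_civita_up ::
    "realization \<Rightarrow> nat \<Rightarrow> nat \<Rightarrow> nat \<Rightarrow> nat \<Rightarrow> nat \<Rightarrow> complex" where
  "levi_civita_up L a b c d e =
     (\<Sum>a'\<in>{1..5}. \<Sum>b'\<in>{1..5}. \<Sum>c'\<in>{1..5}. \<Sum>d'\<in>{1..5}. \<Sum>e'\<in>{1..5}.
        inv_metric L a a' * inv_metric L b b' * inv_metric L c c' * inv_metric L d d'
          * inv_metric L e e' * levi_civita a' b' c' d' e')"

definition w_up :: "realization \<Rightarrow> (generator \<Rightarrow> 'x op) \<Rightarrow> nat \<Rightarrow> 'x op" where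
  "w_up L \<rho> a = (1/8) *\<^sub>o
     (\<Sum>b\<in>{1..5}. \<Sum>c\<in>{1..5}. \<Sum>d\<in>{1..5}. \<Sum>e\<in>{1..5}.
        levi_civita_up L a b c d e *\<^sub>o (M L \<rho> b c \<circ> M L \<rho> d e))"

definition w_down :: "realization \<Rightarrow> (generator \<Rightarrow> 'x op) \<Rightarrow> nat \<Rightarrow> 'x op" where
  "w_down L \<rho> a = (\<Sum>b\<in>{1..5}. metric L a b *\<^sub>o w_up L \<rho> b)"

definition casimir2 :: "realization \<Rightarrow> (generator \<Rightarrow> 'x op) \<Rightarrow> 'x op" where
  "casimir2 L \<rho> = (- 1/2) *\<^sub>o (\<Sum>a\<in>{1..5}. \<Sum>b\<in>{1..5}. M L \<rho> a b \<circ> M_up L \<rho> a b)"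

definition casimir4 :: "realization \<Rightarrow> (generator \<Rightarrow> 'x op) \<Rightarrow> 'x op" where
  "casimir4 L \<rho> = - (\<Sum>a\<in>{1..5}. w_down L \<rho> a \<circ> w_up L \<rho> a)"

end

(* The components w^a of the Pauli-Lubanski type vector already annihilate the generalized solid
   harmonics, so c4 = 0 follows at once. After decomposing by weight, w^a = 0 becomes five
   quadratic relations between the generators (the antisymmetrization of M_ab M_cd vanishes in the
   singleton representation); a sixth relation gives c2. Since only two generators are applied in
   succession, these relations can be checked on any function r^nu g(theta) e^(i mu phi) whose
   profile g solves the associated Legendre equation, and none of the ladder relations for the
   Ferrers functions is required. *)
theory Submission
  imports Defs
begin

text \<open>The quartic Casimir applies four generators in a row, yet two suffice. Every component
  \<open>w_up\<close> kills the function on the whole open domain, and a generator depends only on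
  the values inside the domain. The outer component of w therefore acts on a function
  indistinguishable from zero, and regularity of second order (\<open>D2\<close>) is enough. The
  differential operators and the infinite matrices share only two features that matter here:
  linearity on a class \<open>D\<close> and locality on a set \<open>U\<close>. The locale
  \<open>local_representation\<close> isolates them, so the passage from the quadratic relations to
  the Casimirs is made once for both pictures and all four realizations. The remaining obstacle is
  that \<open>ferrersP\<close> is defined by cases, with a limit at positive integers \<mu>.
  Dividing the hypergeometric series by Gamma(1 - \<mu>) term by term gives one formula valid for
  every \<mu>. A geometric bound on its terms, locally uniform in \<mu>, justifies the limit, and a
  recurrence between its coefficients is the source of the Legendre equation.\<close>

subsection \<open>Tensor operators\<close>

lemma scale_op_apply [simp]: "(c *\<^sub>o A) f x = c * A f x"
  by (simp add: scale_op_def)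

lemma sum_op_apply: "(\<Sum>i\<in>I. A i) f x = (\<Sum>i\<in>I. A i f x)"
  for A :: "'i \<Rightarrow> 'x op"
  by (induction I rule: infinite_finite_induct) auto

lemma atLeastAtMost_1_5: "{1..5::nat} = {1, 2, 3, 4, 5}"
  by auto

text \<open>Only the 24 arrangements of the four indices other than \<open>a\<close> survive. Swaps
  inside the two pairs group them into six classes of four, one class for each choice of the first
  pair. The second skewness is restricted to indices in range because it will come from linearity of
  the entries of \<open>M\<close>, which is known only there.\<close>

lemma levi_civita_contract:
  fixes T :: "nat \<Rightarrow> nat \<Rightarrow> nat \<Rightarrow> nat \<Rightarrow> complex"
  assumes "\<And>b c d e. T c b d e = - T b c d e"
    and "\<And>b c d e. b \<in> {1..5} \<Longrightarrow> c \<in> {1..5} \<Longrightarrow> d \<in> {1..5} \<Longrightarrow> e \<in> {1..5} \<Longrightarrow> T b c e d = - T b c d e"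
  defines "C a \<equiv> (\<Sum>b\<in>{1..5}. \<Sum>c\<in>{1..5}. \<Sum>d\<in>{1..5}. \<Sum>e\<in>{1..5}. levi_civita a b c d e * T b c d e)"
  shows
   "C 1 = 4 * (T 2 3 4 5 + T 4 5 2 3 - T 2 4 3 5 - T 3 5 2 4 + T 2 5 3 4 + T 3 4 2 5)"
   "C 2 = - 4 * (T 1 3 4 5 + T 4 5 1 3 - T 1 4 3 5 - T 3 5 1 4 + T 1 5 3 4 + T 3 4 1 5)"
   "C 3 = 4 * (T 1 2 4 5 + T 4 5 1 2 - T 1 4 2 5 - T 2 5 1 4 + T 1 5 2 4 + T 2 4 1 5)"
   "C 4 = - 4 * (T 1 2 3 5 + T 3 5 1 2 - T 1 3 2 5 - T 2 5 1 3 + T 1 5 2 3 + T 2 3 1 5)"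
   "C 5 = 4 * (T 1 2 3 4 + T 3 4 1 2 - T 1 3 2 4 - T 2 4 1 3 + T 1 4 2 3 + T 2 3 1 4)"
proof -
  \<comment> \<open>The swapped pair is instantiated, since the general skewness laws would loop as
    rewrite rules.\<close>
  note a = assms(1)[of 1 2] assms(1)[of 1 3] assms(1)[of 1 4] assms(1)[of 1 5] assms(1)[of 2 3]
     assms(1)[of 2 4] assms(1)[of 2 5] assms(1)[of 3 4] assms(1)[of 3 5] assms(1)[of 4 5]
     assms(2)[of _ _ 1 2] assms(2)[of _ _ 1 3] assms(2)[of _ _ 1 4] assms(2)[of _ _ 1 5] assms(2)[of _ _ 2 3]
     assms(2)[of _ _ 2 4] assms(2)[of _ _ 2 5] assms(2)[of _ _ 3 4] assms(2)[of _ _ 3 5] assms(2)[of _ _ 4 5]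
  show "C 1 = 4 * (T 2 3 4 5 + T 4 5 2 3 - T 2 4 3 5 - T 3 5 2 4 + T 2 5 3 4 + T 3 4 2 5)"
   "C 2 = - 4 * (T 1 3 4 5 + T 4 5 1 3 - T 1 4 3 5 - T 3 5 1 4 + T 1 5 3 4 + T 3 4 1 5)"
   "C 3 = 4 * (T 1 2 4 5 + T 4 5 1 2 - T 1 4 2 5 - T 2 5 1 4 + T 1 5 2 4 + T 2 4 1 5)"
   "C 4 = - 4 * (T 1 2 3 5 + T 3 5 1 2 - T 1 3 2 5 - T 2 5 1 3 + T 1 5 2 3 + T 2 3 1 5)"
   "C 5 = 4 * (T 1 2 3 4 + T 3 4 1 2 - T 1 3 2 4 - T 2 4 1 3 + T 1 4 2 3 + T 2 3 1 4)"
    unfolding C_def atLeastAtMost_1_5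
    by (simp_all add: levi_civita_expand a del: One_nat_def)
qed

lemma M_skew: "M L \<rho> b a = - M L \<rho> a b"
  by (auto simp: M_def)

lemma M_entries:
  "M L \<rho> 1 2 = M_rows L \<rho> ! 0 ! 0" "M L \<rho> 1 3 = M_rows L \<rho> ! 0 ! Suc 0"
  "M L \<rho> 1 4 = M_rows L \<rho> ! 0 ! 2" "M L \<rho> 1 5 = M_rows L \<rho> ! 0 ! 3"
  "M L \<rho> 2 3 = M_rows L \<rho> ! Suc 0 ! 0" "M L \<rho> 2 4 = M_rows L \<rho> ! Suc 0 ! Suc 0"
  "M L \<rho> 2 5 = M_rows L \<rho> ! Suc 0 ! 2" "M L \<rho> 3 4 = M_rows L \<rho> ! 2 ! 0"
  "M L \<rho> 3 5 = M_rows L \<rho> ! 2 ! Suc 0" "M L \<rho> 4 5 = M_rows L \<rho> ! 3 ! 0"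
  by (simp_all add: M_def)

text \<open>\<open>D\<close> plays the role of the differentiable functions, and values outside \<open>U\<close> are irrelevant.\<close>

locale local_representation =
  fixes \<rho> :: "generator \<Rightarrow> 'x op" and U :: "'x set" and D :: "('x \<Rightarrow> complex) set"
  assumes add_in: "\<And>f g. f \<in> D \<Longrightarrow> g \<in> D \<Longrightarrow> f + g \<in> D"
    and scale_in: "\<And>c f. f \<in> D \<Longrightarrow> (\<lambda>x. c * f x) \<in> D"
    and zero_in: "(\<lambda>x. 0) \<in> D"
    and cong_in: "\<And>f g. f \<in> D \<Longrightarrow> (\<And>x. x \<in> U \<Longrightarrow> f x = g x) \<Longrightarrow> g \<in> D"
    and rho_add: "\<And>f g p X. f \<in> D \<Longrightarrow> g \<in> D \<Longrightarrow> p \<in> U \<Longrightarrow> \<rho> X (f + g) p = \<rho> X f p + \<rho> X g p"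
    and rho_scale: "\<And>f p X c. f \<in> D \<Longrightarrow> p \<in> U \<Longrightarrow> \<rho> X (\<lambda>x. c * f x) p = c * \<rho> X f p"
    and rho_cong: "\<And>f g p X. p \<in> U \<Longrightarrow> (\<And>x. x \<in> U \<Longrightarrow> f x = g x) \<Longrightarrow> \<rho> X f p = \<rho> X g p"
begin

section \<open>Consequences of linearity and locality\<close>

lemma uminus_in: "f \<in> D \<Longrightarrow> - f \<in> D"
  using scale_in[of f "-1"] by (simp add: fun_Compl_def)

lemma rho_uminus: "f \<in> D \<Longrightarrow> p \<in> U \<Longrightarrow> \<rho> X (- f) p = - \<rho> X f p"
  using rho_scale[of f p X "-1"] by (simp add: fun_Compl_def)

lemma diff_in: "f \<in> D \<Longrightarrow> g \<in> D \<Longrightarrow> f - g \<in> D"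
  using add_in[OF _ uminus_in, of f g] by simp

lemma rho_diff: "f \<in> D \<Longrightarrow> g \<in> D \<Longrightarrow> p \<in> U \<Longrightarrow> \<rho> X (f - g) p = \<rho> X f p - \<rho> X g p"
  using rho_add[OF _ uminus_in, of f g p X] by (simp add: rho_uminus)

lemma scale_op_in: "A f \<in> D \<Longrightarrow> (c *\<^sub>o A) f \<in> D"
  unfolding scale_op_def by (rule scale_in)

lemma rho_scale_op: "A f \<in> D \<Longrightarrow> p \<in> U \<Longrightarrow> \<rho> X ((c *\<^sub>o A) f) p = c * \<rho> X (A f) p"
  unfolding scale_op_def by (rule rho_scale)

lemma rho_zero: "p \<in> U \<Longrightarrow> \<rho> X (\<lambda>x. 0) p = 0"
  using rho_scale[OF zero_in, of p X 0] by simp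

lemma rho_vanish: "p \<in> U \<Longrightarrow> (\<And>x. x \<in> U \<Longrightarrow> f x = 0) \<Longrightarrow> \<rho> X f p = 0"
  using rho_cong[of p f "\<lambda>x. 0" X] rho_zero by simp

lemmas rho_linear = rho_add rho_diff rho_uminus rho_scale_op add_in diff_in uminus_in scale_op_in

text \<open>Enough to apply two generators in succession: the outer one then acts linearly on
  results of the inner one.\<close>

definition D2 :: "('x \<Rightarrow> complex) set" where
  "D2 = {f \<in> D. \<forall>X. \<rho> X f \<in> D}"

definition anticomm :: "generator \<Rightarrow> generator \<Rightarrow> ('x \<Rightarrow> complex) \<Rightarrow> 'x \<Rightarrow> complex" where
  "anticomm X Y f p = \<rho> X (\<rho> Y f) p + \<rho> Y (\<rho> X f) p"

text \<open>In terms of \<open>shift\<close>, the first five relations have weights (1,0), (-1,0),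
  (0,1), (0,-1), (0,0). These are the weights of the five-dimensional vector representation, as
  befits the components of w. The last relation is the quadratic Casimir written in generators of
  definite weight.\<close>

definition singleton_relations :: "('x \<Rightarrow> complex) \<Rightarrow> 'x \<Rightarrow> bool" where
  "singleton_relations f p \<longleftrightarrow>
     2 * anticomm (Kpm Plus) J3 f p = anticomm (Rpm Plus) (Jpm Minus) f p - anticomm (Spm Plus) (Jpm Plus) f p \<and>
     2 * anticomm (Kpm Minus) J3 f p = anticomm (Rpm Minus) (Jpm Plus) f p - anticomm (Spm Minus) (Jpm Minus) f p \<and>
     2 * anticomm (Jpm Plus) K3 f p = anticomm (Rpm Plus) (Kpm Minus) f p + anticomm (Spm Minus) (Kpm Plus) f p \<and>
     2 * anticomm (Jpm Minus) K3 f p = anticomm (Rpm Minus) (Kpm Plus) f p + anticomm (Spm Plus) (Kpm Minus) f p \<and>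
     4 * anticomm J3 K3 f p = anticomm (Rpm Plus) (Rpm Minus) f p - anticomm (Spm Plus) (Spm Minus) f p \<and>
     \<rho> K3 (\<rho> K3 f) p + \<rho> J3 (\<rho> J3 f) p + anticomm (Jpm Plus) (Jpm Minus) f p / 2
       - anticomm (Kpm Plus) (Kpm Minus) f p / 2 - anticomm (Rpm Plus) (Rpm Minus) f p / 4
       - anticomm (Spm Plus) (Spm Minus) f p / 4 = - 5/4 * f p"

text \<open>Off the diagonal an entry is a combination of generators, and locality alone makes each
  of these zero on \<open>U\<close>. The index range matters because \<open>!\<close> is unspecified
  beyond the end of a list.\<close>

lemma M_vanish:
  assumes "\<And>x. x \<in> U \<Longrightarrow> f x = 0" "x \<in> U" "a \<in> {1..5}" "b \<in> {1..5}"
  shows "M L \<rho> a b f x = 0"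
proof -
  have "\<rho> X f x = 0" for X
    using rho_vanish[OF assms(2,1)] by simp
  then have 0: "\<forall>A \<in> {J1 \<rho>, J2 \<rho>, \<rho> J3, \<rho> K3, PC1 \<rho> Plus, PC2 \<rho> Plus, PC3 \<rho> Plus, PC1 \<rho> Minus, PC2 \<rho> Minus, PC3 \<rho> Minus}. A f x = 0"
    by (simp add: PC1_def PC2_def PC3_def J1_def J2_def Let_def)
  have upper: "M L \<rho> a b f x = 0" if "a < b" "a \<in> {1..5}" "b \<in> {1..5}" for a b
  proof -
    have "(a, b) \<in> {(1,2),(1,3),(1,4),(1,5),(2,3),(2,4),(2,5),(3,4),(3,5),(4,5)}"
      using that unfolding atLeastAtMost_1_5 by (elim insertE emptyE) simp_all
    then show ?thesis
      by (cases L; elim insertE emptyE; simp add: M_entries 0 del: One_nat_def)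
  qed
  consider "a < b" | "b < a" | "a = b" by linarith
  then show ?thesis
    using upper[of a b] upper[of b a] assms(3,4) M_skew[of L \<rho> a b] by cases (auto simp: M_def)
qed

lemma w_up_vanish:
  assumes "\<And>x. x \<in> U \<Longrightarrow> f x = 0" "x \<in> U"
  shows "w_up L \<rho> a f x = 0"
  using M_vanish[OF M_vanish[OF assms(1)] assms(2)] by (simp add: w_up_def sum_op_apply)

lemma M_up_eq:
  assumes "a \<in> {1..5}" "b \<in> {1..5}"
  shows "M_up L \<rho> a b = (inv_metric L a a * inv_metric L b b) *\<^sub>o M L \<rho> a b"
proof (intro ext)
  fix f x
  have "M_up L \<rho> a b f x = (\<Sum>c\<in>{1..5}. \<Sum>d\<in>{1..5}. if b = d then (if a = c then inv_metric L a a * inv_metric L b b * M L \<rho> a b f x else 0) else 0)"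
    unfolding M_up_def sum_op_apply by (intro sum.cong refl) (auto simp: inv_metric_def)
  then show "M_up L \<rho> a b f x = ((inv_metric L a a * inv_metric L b b) *\<^sub>o M L \<rho> a b) f x"
    using assms by simp
qed

lemma M_diag: "M L \<rho> a a = 0" by (simp add: M_def)

lemma D2_D: "f \<in> D2 \<Longrightarrow> f \<in> D" "f \<in> D2 \<Longrightarrow> \<rho> X f \<in> D" by (auto simp: D2_def)

text \<open>Each relation is solved for one product of two generators. None of the six products on
  the left recurs on any right-hand side, so the equations form a terminating elimination.\<close>

lemma singleton_relations_solved:
  assumes "singleton_relations f p"
  shows
    "\<rho> J3 (\<rho> (Kpm Plus) f) p = (anticomm (Rpm Plus) (Jpm Minus) f p - anticomm (Spm Plus) (Jpm Plus) f p) / 2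
       - \<rho> (Kpm Plus) (\<rho> J3 f) p"
    "\<rho> J3 (\<rho> (Kpm Minus) f) p = (anticomm (Rpm Minus) (Jpm Plus) f p - anticomm (Spm Minus) (Jpm Minus) f p) / 2
       - \<rho> (Kpm Minus) (\<rho> J3 f) p"
    "\<rho> K3 (\<rho> (Jpm Plus) f) p = (anticomm (Rpm Plus) (Kpm Minus) f p + anticomm (Spm Minus) (Kpm Plus) f p) / 2
       - \<rho> (Jpm Plus) (\<rho> K3 f) p"
    "\<rho> K3 (\<rho> (Jpm Minus) f) p = (anticomm (Rpm Minus) (Kpm Plus) f p + anticomm (Spm Plus) (Kpm Minus) f p) / 2
       - \<rho> (Jpm Minus) (\<rho> K3 f) p"
    "\<rho> K3 (\<rho> J3 f) p = (anticomm (Rpm Plus) (Rpm Minus) f p - anticomm (Spm Plus) (Spm Minus) f p) / 4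
       - \<rho> J3 (\<rho> K3 f) p"
    "\<rho> K3 (\<rho> K3 f) p = anticomm (Kpm Plus) (Kpm Minus) f p / 2 + anticomm (Rpm Plus) (Rpm Minus) f p / 4
       + anticomm (Spm Plus) (Spm Minus) f p / 4 - \<rho> J3 (\<rho> J3 f) p - anticomm (Jpm Plus) (Jpm Minus) f p / 2 - 5/4 * f p"
proof -
  note rels = assms[unfolded singleton_relations_def]
  have half: "x = z / 2 - y" if "2 * (y + x) = z" for x y z :: complex
    using that by (simp add: field_simps flip: that)
  have quarter: "x = z / 4 - y" if "4 * (y + x) = z" for x y z :: complex
    using that by (simp add: field_simps flip: that)
  show
    "\<rho> J3 (\<rho> (Kpm Plus) f) p = (anticomm (Rpm Plus) (Jpm Minus) f p - anticomm (Spm Plus) (Jpm Plus) f p) / 2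
       - \<rho> (Kpm Plus) (\<rho> J3 f) p"
    "\<rho> J3 (\<rho> (Kpm Minus) f) p = (anticomm (Rpm Minus) (Jpm Plus) f p - anticomm (Spm Minus) (Jpm Minus) f p) / 2
       - \<rho> (Kpm Minus) (\<rho> J3 f) p"
    "\<rho> K3 (\<rho> (Jpm Plus) f) p = (anticomm (Rpm Plus) (Kpm Minus) f p + anticomm (Spm Minus) (Kpm Plus) f p) / 2
       - \<rho> (Jpm Plus) (\<rho> K3 f) p"
    "\<rho> K3 (\<rho> (Jpm Minus) f) p = (anticomm (Rpm Minus) (Kpm Plus) f p + anticomm (Spm Plus) (Kpm Minus) f p) / 2
       - \<rho> (Jpm Minus) (\<rho> K3 f) p"
    "\<rho> K3 (\<rho> J3 f) p = (anticomm (Rpm Plus) (Rpm Minus) f p - anticomm (Spm Plus) (Spm Minus) f p) / 4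
       - \<rho> J3 (\<rho> K3 f) p"
    using rels by (intro half quarter; simp add: anticomm_def)+
  have "\<rho> K3 (\<rho> K3 f) p + \<rho> J3 (\<rho> J3 f) p + anticomm (Jpm Plus) (Jpm Minus) f p / 2
       - anticomm (Kpm Plus) (Kpm Minus) f p / 2 - anticomm (Rpm Plus) (Rpm Minus) f p / 4
       - anticomm (Spm Plus) (Spm Minus) f p / 4 = - 5/4 * f p"
    using rels by blast
  then show "\<rho> K3 (\<rho> K3 f) p = anticomm (Kpm Plus) (Kpm Minus) f p / 2 + anticomm (Rpm Plus) (Rpm Minus) f p / 4
       + anticomm (Spm Plus) (Spm Minus) f p / 4 - \<rho> J3 (\<rho> J3 f) p - anticomm (Jpm Plus) (Jpm Minus) f p / 2 - 5/4 * f p"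
    by (simp add: algebra_simps)
qed

text \<open>Needed for skewness of \<open>M L \<rho> b c (M L \<rho> d e f) p\<close> in
  \<open>d\<close> and \<open>e\<close>: the inner sign must pass through the outer operator, which
  is linear only on \<open>D\<close>.\<close>

lemma M_linear:
  assumes "f \<in> D2" "p \<in> U" "a \<in> {1..5}" "b \<in> {1..5}"
  shows "M L \<rho> a b f \<in> D" "g \<in> D \<Longrightarrow> M L \<rho> a b (- g) p = - M L \<rho> a b g p"
proof -
  have basic: "\<forall>A \<in> {J1 \<rho>, J2 \<rho>, \<rho> J3, \<rho> K3, PC1 \<rho> Plus, PC2 \<rho> Plus, PC3 \<rho> Plus, PC1 \<rho> Minus, PC2 \<rho> Minus, PC3 \<rho> Minus}.
      A f \<in> D \<and> (g \<in> D \<longrightarrow> A (- g) p = - A g p)"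
    using assms by (simp add: PC1_def PC2_def PC3_def J1_def J2_def Let_def rho_linear D2_D algebra_simps)
  have upper: "M L \<rho> a b f \<in> D \<and> (g \<in> D \<longrightarrow> M L \<rho> a b (- g) p = - M L \<rho> a b g p)"
    if "a < b" "a \<in> {1..5}" "b \<in> {1..5}" for a b
  proof -
    have "(a, b) \<in> {(1,2),(1,3),(1,4),(1,5),(2,3),(2,4),(2,5),(3,4),(3,5),(4,5)}"
      using that unfolding atLeastAtMost_1_5 by (elim insertE emptyE) simp_all
    then show ?thesis
      by (cases L; elim insertE emptyE; simp add: M_entries basic rho_linear del: One_nat_def)
  qed
  have "M L \<rho> a b f \<in> D \<and> (g \<in> D \<longrightarrow> M L \<rho> a b (- g) p = - M L \<rho> a b g p)"
  proof -
    consider "a < b" | "b < a" | "a = b" by linarith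
    then show ?thesis
      using upper[of a b] upper[of b a] assms(3,4) M_skew[of L \<rho> a b] zero_in
      by cases (auto simp: M_def uminus_in zero_fun_def)
  qed
  then show "M L \<rho> a b f \<in> D" "g \<in> D \<Longrightarrow> M L \<rho> a b (- g) p = - M L \<rho> a b g p"
    by auto
qed

text \<open>Up to sign, these are the components of \<open>2 w f\<close>.\<close>

lemma M_Pluecker:
  fixes L :: realization
  assumes "f \<in> D2" "p \<in> U" "singleton_relations f p"
  defines "T \<equiv> \<lambda>b c d e. M L \<rho> b c (M L \<rho> d e f) p"
  shows
   "T 2 3 4 5 + T 4 5 2 3 - T 2 4 3 5 - T 3 5 2 4 + T 2 5 3 4 + T 3 4 2 5 = 0"
   "T 1 3 4 5 + T 4 5 1 3 - T 1 4 3 5 - T 3 5 1 4 + T 1 5 3 4 + T 3 4 1 5 = 0"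
   "T 1 2 4 5 + T 4 5 1 2 - T 1 4 2 5 - T 2 5 1 4 + T 1 5 2 4 + T 2 4 1 5 = 0"
   "T 1 2 3 5 + T 3 5 1 2 - T 1 3 2 5 - T 2 5 1 3 + T 1 5 2 3 + T 2 3 1 5 = 0"
   "T 1 2 3 4 + T 3 4 1 2 - T 1 3 2 4 - T 2 4 1 3 + T 1 4 2 3 + T 2 3 1 4 = 0"
  \<comment> \<open>Everything expands into products of two generators. The solved relations
    eliminate six of these products, and the rest cancels identically in each realization.\<close>
  using assms(1,2) unfolding T_def
  by (cases L; simp add: M_entries J1_def J2_def PC1_def PC2_def PC3_def Let_def rho_linear D2_D
   singleton_relations_solved[OF assms(3)] anticomm_def del: One_nat_def; simp add: field_simps)+

text \<open>Allows the computation of the quadratic Casimir to keep these operators folded and to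
  move only signs and factors of i through them.\<close>

lemma PC_linear:
  assumes "p \<in> U"
  shows "B f \<in> D \<Longrightarrow> J1 \<rho> ((c *\<^sub>o B) f) p = c * J1 \<rho> (B f) p"
    "B f \<in> D \<Longrightarrow> J2 \<rho> ((c *\<^sub>o B) f) p = c * J2 \<rho> (B f) p"
    "B f \<in> D \<Longrightarrow> PC1 \<rho> s ((c *\<^sub>o B) f) p = c * PC1 \<rho> s (B f) p"
    "B f \<in> D \<Longrightarrow> PC2 \<rho> s ((c *\<^sub>o B) f) p = c * PC2 \<rho> s (B f) p"
    "B f \<in> D \<Longrightarrow> PC3 \<rho> s ((c *\<^sub>o B) f) p = c * PC3 \<rho> s (B f) p"
    "h \<in> D \<Longrightarrow> J1 \<rho> (- h) p = - J1 \<rho> h p"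
    "h \<in> D \<Longrightarrow> J2 \<rho> (- h) p = - J2 \<rho> h p"
    "h \<in> D \<Longrightarrow> PC1 \<rho> s (- h) p = - PC1 \<rho> s h p"
    "h \<in> D \<Longrightarrow> PC2 \<rho> s (- h) p = - PC2 \<rho> s h p"
    "h \<in> D \<Longrightarrow> PC3 \<rho> s (- h) p = - PC3 \<rho> s h p"
  using assms by (simp_all add: PC1_def PC2_def PC3_def J1_def J2_def Let_def rho_linear algebra_simps)

lemma PC_in:
  assumes "f \<in> D2"
  shows "J1 \<rho> f \<in> D" "J2 \<rho> f \<in> D" "PC1 \<rho> s f \<in> D" "PC2 \<rho> s f \<in> D" "PC3 \<rho> s f \<in> D"
  using assms by (simp_all add: PC1_def PC2_def PC3_def J1_def J2_def Let_def rho_linear D2_D)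

text \<open>A difference of squares of a sum and a difference leaves only products of raising with
  lowering operators. The mixed products of \<open>Rpm\<close> with \<open>Spm\<close> cancel only
  between the components 1 and 2, which is why those two are treated together.\<close>

lemma PC_squares:
  assumes "f \<in> D2" "p \<in> U"
  shows "PC1 \<rho> Minus (PC1 \<rho> Minus f) p - PC1 \<rho> Plus (PC1 \<rho> Plus f) p + PC2 \<rho> Minus (PC2 \<rho> Minus f) p
      - PC2 \<rho> Plus (PC2 \<rho> Plus f) p = - (anticomm (Rpm Plus) (Rpm Minus) f p + anticomm (Spm Plus) (Spm Minus) f p) / 4"
    "PC3 \<rho> Minus (PC3 \<rho> Minus f) p - PC3 \<rho> Plus (PC3 \<rho> Plus f) p = - anticomm (Kpm Plus) (Kpm Minus) f p / 2"
    "J1 \<rho> (J1 \<rho> f) p + J2 \<rho> (J2 \<rho> f) p = anticomm (Jpm Plus) (Jpm Minus) f p / 2"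
  using assms
  by (simp_all add: PC1_def PC2_def PC3_def J1_def J2_def Let_def rho_linear D2_D anticomm_def; simp add: field_simps)+

lemma casimir2_eq:
  assumes "f \<in> D2" "p \<in> U" "singleton_relations f p"
  shows "casimir2 L \<rho> f p = - 5/4 * f p"
proof -
  have "casimir2 L \<rho> f p = - 1/2 * (\<Sum>a\<in>{1..5}. \<Sum>b\<in>{1..5}. M L \<rho> a b (M_up L \<rho> a b f) p)"
    by (simp add: casimir2_def sum_op_apply)
  also have "\<dots> = - 1/2 * (\<Sum>a\<in>{1..5}. \<Sum>b\<in>{1..5}. M L \<rho> a b (((inv_metric L a a * inv_metric L b b) *\<^sub>o M L \<rho> a b) f) p)"
    by (simp add: M_up_eq)
  \<comment> \<open>The factors of i in the entries compensate the signs of the metric, so all four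
    realizations lead to this same sum of squares. Each index pair is counted twice, which absorbs
    the 1/2.\<close>
  also have "\<dots> = (PC1 \<rho> Minus (PC1 \<rho> Minus f) p - PC1 \<rho> Plus (PC1 \<rho> Plus f) p + PC2 \<rho> Minus (PC2 \<rho> Minus f) p
      - PC2 \<rho> Plus (PC2 \<rho> Plus f) p) + (PC3 \<rho> Minus (PC3 \<rho> Minus f) p - PC3 \<rho> Plus (PC3 \<rho> Plus f) p)
      + (J1 \<rho> (J1 \<rho> f) p + J2 \<rho> (J2 \<rho> f) p) + \<rho> J3 (\<rho> J3 f) p + \<rho> K3 (\<rho> K3 f) p"
    using assms(1,2) unfolding atLeastAtMost_1_5
    by (cases L; simp add: M_diag M_skew[of _ \<rho> 2 1] M_skew[of _ \<rho> 3 1] M_skew[of _ \<rho> 4 1] M_skew[of _ \<rho> 5 1]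
        M_skew[of _ \<rho> 3 2] M_skew[of _ \<rho> 4 2] M_skew[of _ \<rho> 5 2] M_skew[of _ \<rho> 4 3] M_skew[of _ \<rho> 5 3]
        M_skew[of _ \<rho> 5 4] M_entries PC_linear PC_in rho_linear D2_D inv_metric_def del: One_nat_def;
        simp add: field_simps)
  also have "\<dots> = - 5/4 * f p"
    unfolding PC_squares[OF assms(1,2)] singleton_relations_solved(6)[OF assms(3)] by (simp add: field_simps)
  finally show ?thesis .
qed

lemma w_up_eq_0:
  assumes "f \<in> D2" "p \<in> U" "singleton_relations f p" "a \<in> {1..5}"
  shows "w_up L \<rho> a f p = 0"
proof -
  define G where "G i = inv_metric L i i" for i
  \<comment> \<open>A diagonal metric raises indices by rescaling. The weights of the four summed
    indices go into \<open>T\<close>, and the symbol with lower indices remains.\<close>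
  define T where "T b c d e = G b * G c * G d * G e * M L \<rho> b c (M L \<rho> d e f) p" for b c d e
  have up: "levi_civita_up L a b c d e = G a * G b * G c * G d * G e * levi_civita a b c d e"
    if "b \<in> {1..5}" "c \<in> {1..5}" "d \<in> {1..5}" "e \<in> {1..5}" for b c d e
  proof -
    \<comment> \<open>The conditions are nested so that the innermost sum, over e', meets its own
      condition first and collapses; the others follow outwards.\<close>
    have "levi_civita_up L a b c d e = (\<Sum>a'\<in>{1..5}. \<Sum>b'\<in>{1..5}. \<Sum>c'\<in>{1..5}. \<Sum>d'\<in>{1..5}. \<Sum>e'\<in>{1..5}.
       if e = e' then if d = d' then if c = c' then if b = b' then if a = a'
       then G a * G b * G c * G d * G e * levi_civita a b c d e else 0 else 0 else 0 else 0 else 0)"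
      unfolding levi_civita_up_def by (intro sum.cong refl) (auto simp: inv_metric_def G_def)
    then show ?thesis
      using that assms(4) by simp
  qed
  have "w_up L \<rho> a f p = G a / 8 * (\<Sum>b\<in>{1..5}. \<Sum>c\<in>{1..5}. \<Sum>d\<in>{1..5}. \<Sum>e\<in>{1..5}. levi_civita a b c d e * T b c d e)"
    unfolding w_up_def scale_op_apply sum_op_apply sum_distrib_left
    by (intro sum.cong refl) (simp add: up T_def)
  also have "(\<Sum>b\<in>{1..5}. \<Sum>c\<in>{1..5}. \<Sum>d\<in>{1..5}. \<Sum>e\<in>{1..5}. levi_civita a b c d e * T b c d e) = 0"
  proof -
    have skew1: "T c b d e = - T b c d e" for b c d e
      by (simp add: T_def M_skew[of L \<rho> c b])
    have skew2: "T b c e d = - T b c d e"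
      if "b \<in> {1..5}" "c \<in> {1..5}" "d \<in> {1..5}" "e \<in> {1..5}" for b c d e
      using M_linear[OF assms(1,2)] that by (simp add: T_def M_skew[of L \<rho> e d])
    \<comment> \<open>All six terms involve the same four indices, so their weights form a common
      factor.\<close>
    have T_sum: "T i j k l + T k l i j - T i k j l - T j l i k + T i l j k + T j k i l =
        G i * G j * G k * G l * (M L \<rho> i j (M L \<rho> k l f) p + M L \<rho> k l (M L \<rho> i j f) p - M L \<rho> i k (M L \<rho> j l f) p
          - M L \<rho> j l (M L \<rho> i k f) p + M L \<rho> i l (M L \<rho> j k f) p + M L \<rho> j k (M L \<rho> i l f) p)" for i j k l
      by (simp add: T_def algebra_simps)
    from assms(4) consider "a = 1" | "a = 2" | "a = 3" | "a = 4" | "a = 5"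
      unfolding atLeastAtMost_1_5 by blast
    then show ?thesis
      by cases (simp_all only: levi_civita_contract[OF skew1 skew2] T_sum M_Pluecker[OF assms(1-3)] mult_zero_right)
  qed
  finally show ?thesis by simp
qed

lemma casimir4_eq_0:
  assumes "f \<in> D2" "\<And>q. q \<in> U \<Longrightarrow> singleton_relations f q" "p \<in> U"
  shows "casimir4 L \<rho> f p = 0"
proof -
  \<comment> \<open>The relations are used on all of \<open>U\<close>: the outer component may
    differentiate \<open>w_up L \<rho> a f\<close>, so its vanishing at the single point
    \<open>p\<close> would not do.\<close>
  have "w_up L \<rho> b (w_up L \<rho> a f) p = 0" if "a \<in> {1..5}" for a b
    by (rule w_up_vanish[OF _ assms(3)]) (rule w_up_eq_0[OF assms(1) _ assms(2) that])
  then show ?thesis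
    by (simp add: casimir4_def w_down_def sum_op_apply)
qed

text \<open>Linearity of one generator holds only on \<open>U\<close>, so a second one is reached
  through \<open>cong_in\<close> and \<open>rho_cong\<close> instead of an equation between
  functions.\<close>

lemma D2_combination:
  assumes "f \<in> D2" "g \<in> D2"
  shows "(\<lambda>x. c * f x) + g \<in> D2"
    and "p \<in> U \<Longrightarrow> \<rho> X (\<rho> Y ((\<lambda>x. c * f x) + g)) p = c * \<rho> X (\<rho> Y f) p + \<rho> X (\<rho> Y g) p"
proof -
  have 1: "\<rho> X ((\<lambda>x. c * f x) + g) p = ((\<lambda>x. c * \<rho> X f x) + \<rho> X g) p" if "p \<in> U" for X p
    using that assms by (simp add: rho_add rho_scale scale_in D2_D)
  have "\<rho> X ((\<lambda>x. c * f x) + g) \<in> D" for X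
    by (rule cong_in[OF _ 1[symmetric]]) (intro add_in scale_in D2_D assms)
  moreover have "(\<lambda>x. c * f x) + g \<in> D"
    by (intro add_in scale_in D2_D assms)
  ultimately show "(\<lambda>x. c * f x) + g \<in> D2"
    by (simp add: D2_def)
  assume p: "p \<in> U"
  have "\<rho> X (\<rho> Y ((\<lambda>x. c * f x) + g)) p = \<rho> X ((\<lambda>x. c * \<rho> Y f x) + \<rho> Y g) p"
    by (rule rho_cong[OF p 1])
  then show "\<rho> X (\<rho> Y ((\<lambda>x. c * f x) + g)) p = c * \<rho> X (\<rho> Y f) p + \<rho> X (\<rho> Y g) p"
    using p assms by (simp add: rho_add rho_scale scale_in D2_D)
qed

text \<open>Reduces the relations on a span to its generating functions. The form c f + g is the
  step of induction over a span.\<close>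

lemma singleton_relations_combination:
  assumes "f \<in> D2" "g \<in> D2" "p \<in> U" "singleton_relations f p" "singleton_relations g p"
  shows "singleton_relations ((\<lambda>x. c * f x) + g) p"
proof -
  have "anticomm X Y ((\<lambda>x. c * f x) + g) p = c * anticomm X Y f p + anticomm X Y g p" for X Y
    unfolding anticomm_def D2_combination(2)[OF assms(1-3)] by (simp add: algebra_simps)
  note lin = this D2_combination(2)[OF assms(1-3)]
  have diff: "k * (c * x + x') = (c * y + y') - (c * z + z')" if "k * x = y - z" "k * x' = y' - z'" for k x x' y y' z z'
  proof -
    have "k * (c * x + x') = c * (k * x) + k * x'"
      by (simp add: algebra_simps)
    then show ?thesis
      unfolding that by (simp add: algebra_simps)
  qed
  have add: "k * (c * x + x') = (c * y + y') + (c * z + z')" if "k * x = y + z" "k * x' = y' + z'" for k x x' y y' z z'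
    using diff[of k x y "- z" x' y' "- z'"] that by simp
  have casimir: "(c * x1 + y1) + (c * x2 + y2) + (c * x3 + y3) / 2 - (c * x4 + y4) / 2 - (c * x5 + y5) / 4 - (c * x6 + y6) / 4
      = - 5/4 * (c * u + v)"
    if "x1 + x2 + x3 / 2 - x4 / 2 - x5 / 4 - x6 / 4 = - 5/4 * u" "y1 + y2 + y3 / 2 - y4 / 2 - y5 / 4 - y6 / 4 = - 5/4 * v"
    for x1 x2 x3 x4 x5 x6 y1 y2 y3 y4 y5 y6 u v
  proof -
    have "(c * x1 + y1) + (c * x2 + y2) + (c * x3 + y3) / 2 - (c * x4 + y4) / 2 - (c * x5 + y5) / 4 - (c * x6 + y6) / 4
      = c * (x1 + x2 + x3 / 2 - x4 / 2 - x5 / 4 - x6 / 4) + (y1 + y2 + y3 / 2 - y4 / 2 - y5 / 4 - y6 / 4)"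
      by (simp add: algebra_simps add_divide_distrib)
    then show ?thesis
      unfolding that by (simp add: algebra_simps add_divide_distrib)
  qed
  show ?thesis
    using assms(4,5) unfolding singleton_relations_def lin plus_fun_apply
    by (elim conjE) (intro conjI diff add casimir)
qed

lemma D2_zero: "(\<lambda>x. 0) \<in> D2"
  unfolding D2_def by (auto simp: zero_in rho_zero intro: cong_in[OF zero_in])

lemma singleton_relations_zero:
  assumes "p \<in> U"
  shows "singleton_relations (\<lambda>x. 0) p"
proof -
  have "\<rho> X (\<rho> Y (\<lambda>x. 0)) p = 0" for X Y
    using assms by (intro rho_vanish rho_zero)
  then show ?thesis
    by (simp add: singleton_relations_def anticomm_def)
qed

end

subsection \<open>The matrix representation\<close>

lemma local_representation_matrix_op: "local_representation (matrix_op \<nu>0 \<mu>0) UNIV UNIV"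
proof
  show "matrix_op \<nu>0 \<mu>0 X f p = matrix_op \<nu>0 \<mu>0 X g p"
    if "\<And>x. x \<in> UNIV \<Longrightarrow> f x = g x" for f g p X
    using that by (metis UNIV_I ext)
qed (auto simp: matrix_op_def Let_def algebra_simps split: prod.splits)

text \<open>All products in a relation have the same total shift, so they multiply the same entry of
  \<open>v\<close>, and a polynomial identity in \<nu> = \<nu>0 + n and \<mu> = \<mu>0 + m remains.
  At weight zero the \<open>K3\<close>, \<open>J3\<close> and \<open>Jpm\<close> terms of the last
  relation give 2 \<nu>^2 + 2 \<nu> + 1/4, while the subtracted \<open>Kpm\<close>,
  \<open>Rpm\<close> and \<open>Spm\<close> terms give 2 \<nu>^2 + 2 \<nu> + 3/2. This is the origin
  of -5/4.\<close>

lemma singleton_relations_matrix_op: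
  "local_representation.singleton_relations (matrix_op \<nu>0 \<mu>0) v p"
proof -
  interpret local_representation "matrix_op \<nu>0 \<mu>0" UNIV UNIV
    by (rule local_representation_matrix_op)
  obtain n m where p: "p = (n, m)"
    by force
  show ?thesis
    unfolding singleton_relations_def anticomm_def p
    by (simp add: matrix_op_def Let_def; simp add: algebra_simps; simp add: field_simps)
qed

subsection \<open>Differential operators on separated functions\<close>

lemma solid_domain_iff: "(r, \<theta>, \<phi>) \<in> solid_domain \<longleftrightarrow> 0 < r \<and> 0 < \<theta> \<and> \<theta> < pi"
  by (auto simp: solid_domain_def)

text \<open>Separate differentiability is the right class: the generators use first partial
  derivatives only, and mixed ones never have to be interchanged, being computed explicitly for
  separated functions.\<close>

definition partially_differentiable :: "(point \<Rightarrow> complex) set" where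
  "partially_differentiable = {f. \<forall>(r, \<theta>, \<phi>) \<in> solid_domain.
     (\<exists>d. ((\<lambda>s. f (s, \<theta>, \<phi>)) has_vector_derivative d) (at r)) \<and>
     (\<exists>d. ((\<lambda>s. f (r, s, \<phi>)) has_vector_derivative d) (at \<theta>)) \<and>
     (\<exists>d. ((\<lambda>s. f (r, \<theta>, s)) has_vector_derivative d) (at \<phi>))}"

text \<open>Every coordinate slice of \<open>solid_domain\<close> is open, so a partial derivative
  at a point inside is determined by values inside.\<close>

lemma has_partial_derivative_cong:
  fixes f g :: "point \<Rightarrow> complex"
  assumes "(r, \<theta>, \<phi>) \<in> solid_domain" "\<forall>q\<in>solid_domain. f q = g q"
  shows
    "((\<lambda>s. f (s, \<theta>, \<phi>)) has_vector_derivative d) (at r) \<longleftrightarrow> ((\<lambda>s. g (s, \<theta>, \<phi>)) has_vector_derivative d) (at r)"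
    "((\<lambda>s. f (r, s, \<phi>)) has_vector_derivative d) (at \<theta>) \<longleftrightarrow> ((\<lambda>s. g (r, s, \<phi>)) has_vector_derivative d) (at \<theta>)"
    "((\<lambda>s. f (r, \<theta>, s)) has_vector_derivative d) (at \<phi>) \<longleftrightarrow> ((\<lambda>s. g (r, \<theta>, s)) has_vector_derivative d) (at \<phi>)"
proof -
  have transform: "(u has_vector_derivative d) (at x) \<longleftrightarrow> (v has_vector_derivative d) (at x)"
    if "open S" "x \<in> S" "\<And>y. y \<in> S \<Longrightarrow> u y = v y" for u v :: "real \<Rightarrow> complex" and S x d
    using has_vector_derivative_transform_within_open[of u d x S v]
      has_vector_derivative_transform_within_open[of v d x S u] that by auto
  show "((\<lambda>s. f (s, \<theta>, \<phi>)) has_vector_derivative d) (at r) \<longleftrightarrow> ((\<lambda>s. g (s, \<theta>, \<phi>)) has_vector_derivative d) (at r)"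
    by (rule transform[where S = "{0<..}"]; use assms in \<open>auto simp: solid_domain_iff\<close>)
  show "((\<lambda>s. f (r, s, \<phi>)) has_vector_derivative d) (at \<theta>) \<longleftrightarrow> ((\<lambda>s. g (r, s, \<phi>)) has_vector_derivative d) (at \<theta>)"
    by (rule transform[where S = "{0<..<pi}"]; use assms in \<open>auto simp: solid_domain_iff\<close>)
  show "((\<lambda>s. f (r, \<theta>, s)) has_vector_derivative d) (at \<phi>) \<longleftrightarrow> ((\<lambda>s. g (r, \<theta>, s)) has_vector_derivative d) (at \<phi>)"
    by (rule transform[where S = "UNIV"]; use assms in \<open>auto simp: solid_domain_iff\<close>)
qed

lemma partially_differentiable_iff:
  "f \<in> partially_differentiable \<longleftrightarrow> (\<forall>r \<theta> \<phi>. (r, \<theta>, \<phi>) \<in> solid_domain \<longrightarrow>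
     ((\<lambda>s. f (s, \<theta>, \<phi>)) has_vector_derivative D_r f (r, \<theta>, \<phi>)) (at r) \<and>
     ((\<lambda>s. f (r, s, \<phi>)) has_vector_derivative D_theta f (r, \<theta>, \<phi>)) (at \<theta>) \<and>
     ((\<lambda>s. f (r, \<theta>, s)) has_vector_derivative D_phi f (r, \<theta>, \<phi>)) (at \<phi>))"
proof -
  have "(\<exists>d. (u has_vector_derivative d) (at x)) \<longleftrightarrow> (u has_vector_derivative vector_derivative u (at x)) (at x)"
    for u :: "real \<Rightarrow> complex" and x
    by (metis vector_derivative_at)
  then show ?thesis
    unfolding partially_differentiable_def D_r_def D_theta_def D_phi_def by (simp add: Ball_def)
qed

lemma partial_derivative_add:
  assumes "f \<in> partially_differentiable" "g \<in> partially_differentiable" "p \<in> solid_domain"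
  shows "D_r (f + g) p = D_r f p + D_r g p" "D_theta (f + g) p = D_theta f p + D_theta g p"
    "D_phi (f + g) p = D_phi f p + D_phi g p"
proof -
  obtain r \<theta> \<phi> where p: "p = (r, \<theta>, \<phi>)"
    by (cases p)
  show "D_r (f + g) p = D_r f p + D_r g p"
    using assms unfolding p partially_differentiable_iff D_r_def[of "f + g"] split plus_fun_apply
    by (intro vector_derivative_at has_vector_derivative_add) auto
  show "D_theta (f + g) p = D_theta f p + D_theta g p"
    using assms unfolding p partially_differentiable_iff D_theta_def[of "f + g"] split plus_fun_apply
    by (intro vector_derivative_at has_vector_derivative_add) auto
  show "D_phi (f + g) p = D_phi f p + D_phi g p"
    using assms unfolding p partially_differentiable_iff D_phi_def[of "f + g"] split plus_fun_apply
    by (intro vector_derivative_at has_vector_derivative_add) auto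
qed

lemma partial_derivative_mult:
  assumes "f \<in> partially_differentiable" "p \<in> solid_domain"
  shows "D_r (\<lambda>x. c * f x) p = c * D_r f p" "D_theta (\<lambda>x. c * f x) p = c * D_theta f p"
    "D_phi (\<lambda>x. c * f x) p = c * D_phi f p"
proof -
  obtain r \<theta> \<phi> where p: "p = (r, \<theta>, \<phi>)"
    by (cases p)
  show "D_r (\<lambda>x. c * f x) p = c * D_r f p"
    using assms unfolding p partially_differentiable_iff D_r_def[of "\<lambda>x. c * f x"] split plus_fun_apply
    by (intro vector_derivative_at has_vector_derivative_mult_right) auto
  show "D_theta (\<lambda>x. c * f x) p = c * D_theta f p"
    using assms unfolding p partially_differentiable_iff D_theta_def[of "\<lambda>x. c * f x"] split plus_fun_apply
    by (intro vector_derivative_at has_vector_derivative_mult_right) auto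
  show "D_phi (\<lambda>x. c * f x) p = c * D_phi f p"
    using assms unfolding p partially_differentiable_iff D_phi_def[of "\<lambda>x. c * f x"] split plus_fun_apply
    by (intro vector_derivative_at has_vector_derivative_mult_right) auto
qed

lemma partial_derivative_cong:
  assumes "p \<in> solid_domain" "\<forall>q\<in>solid_domain. f q = g q"
  shows "D_r f p = D_r g p" "D_theta f p = D_theta g p" "D_phi f p = D_phi g p"
proof -
  obtain r \<theta> \<phi> where p: "p = (r, \<theta>, \<phi>)"
    by (cases p)
  show "D_r f p = D_r g p" "D_theta f p = D_theta g p" "D_phi f p = D_phi g p"
    \<comment> \<open>This covers nondifferentiable functions too: \<open>vector_derivative\<close>
      is a choice from the predicate \<open>has_vector_derivative\<close>, and the predicates for
      \<open>f\<close> and \<open>g\<close> coincide.\<close>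
    by (simp_all add: p D_r_def D_theta_def D_phi_def vector_derivative_def
      has_partial_derivative_cong[OF assms(1)[unfolded p] assms(2)])
qed

lemma local_representation_diff_op: "local_representation diff_op solid_domain partially_differentiable"
proof
  fix f g :: "point \<Rightarrow> complex" and c :: complex and p X
  show "f + g \<in> partially_differentiable" if "f \<in> partially_differentiable" "g \<in> partially_differentiable"
    using that partial_derivative_add[OF that] unfolding partially_differentiable_iff
    by (simp add: has_vector_derivative_add)
  show "(\<lambda>x. c * f x) \<in> partially_differentiable" if "f \<in> partially_differentiable"
    using that partial_derivative_mult[OF that] unfolding partially_differentiable_iff
    by (simp add: has_vector_derivative_mult_right)
  show "(\<lambda>x. 0) \<in> partially_differentiable"
    unfolding partially_differentiable_def by (auto intro: has_vector_derivative_const)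
  show "g \<in> partially_differentiable"
    if "f \<in> partially_differentiable" "\<And>x. x \<in> solid_domain \<Longrightarrow> f x = g x"
  proof -
    have eq: "\<forall>q\<in>solid_domain. f q = g q"
      using that(2) by blast
    show ?thesis
      using that(1) has_partial_derivative_cong[OF _ eq] unfolding partially_differentiable_def by (simp add: Ball_def)
  qed
  show "diff_op X (f + g) p = diff_op X f p + diff_op X g p"
    if "f \<in> partially_differentiable" "g \<in> partially_differentiable" "p \<in> solid_domain"
    using partial_derivative_add[OF that]
    by (cases X; cases p) (simp_all add: euler_op_def algebra_simps add_divide_distrib)
  show "diff_op X (\<lambda>x. c * f x) p = c * diff_op X f p"
    if "f \<in> partially_differentiable" "p \<in> solid_domain"
    using partial_derivative_mult[OF that]
    by (cases X; cases p) (simp_all add: euler_op_def algebra_simps add_divide_distrib)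
  show "diff_op X f p = diff_op X g p"
    if "p \<in> solid_domain" "\<And>x. x \<in> solid_domain \<Longrightarrow> f x = g x"
  proof -
    have eq: "\<forall>q\<in>solid_domain. f q = g q"
      using that(2) by blast
    show ?thesis
      using partial_derivative_cong[OF that(1) eq] that(2)[OF that(1)]
      by (cases X; cases p) (simp_all add: euler_op_def)
  qed
qed

section \<open>Separated functions and their angular profiles\<close>

definition separated :: "complex \<Rightarrow> complex \<Rightarrow> (real \<Rightarrow> complex) \<Rightarrow> point \<Rightarrow> complex" where
  "separated \<nu> \<mu> g = (\<lambda>(r, \<theta>, \<phi>). complex_of_real r powr \<nu> * g \<theta> * exp (\<i> * \<mu> * complex_of_real \<phi>))"

text \<open>On a separated function a generator acts on the profile by the first-order operator with
  coefficients \<open>theta_coeff\<close> and \<open>potential\<close>. In the latter, -\<mu> comes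
  from i \<open>D_phi\<close>, and the half-integer shifts come from \<open>euler_op\<close>. The
  argument is complex so that rules for complex derivatives apply.\<close>

primrec theta_coeff :: "generator \<Rightarrow> complex \<Rightarrow> complex" where
  "theta_coeff (Jpm s) z = of_int (pm_sign s)"
| "theta_coeff (Kpm s) z = of_int (pm_sign s) * sin z"
| "theta_coeff (Rpm s) z = of_int (pm_sign s) * cos z"
| "theta_coeff (Spm s) z = - of_int (pm_sign s) * cos z"
| "theta_coeff J3 z = 0"
| "theta_coeff K3 z = 0"

primrec potential :: "generator \<Rightarrow> complex \<Rightarrow> complex \<Rightarrow> complex \<Rightarrow> complex" where
  "potential (Jpm s) \<nu> \<mu> z = - \<mu> * cos z * inverse (sin z)"
| "potential (Kpm s) \<nu> \<mu> z = (\<nu> + (1 + of_int (pm_sign s)) / 2) * cos z"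
| "potential (Rpm s) \<nu> \<mu> z = - \<mu> * inverse (sin z) - (\<nu> + (1 + of_int (pm_sign s)) / 2) * sin z"
| "potential (Spm s) \<nu> \<mu> z = - \<mu> * inverse (sin z) + (\<nu> + (1 + of_int (pm_sign s)) / 2) * sin z"
| "potential J3 \<nu> \<mu> z = \<mu>"
| "potential K3 \<nu> \<mu> z = \<nu> + 1/2"

primrec theta_coeff' :: "generator \<Rightarrow> complex \<Rightarrow> complex" where
  "theta_coeff' (Jpm s) z = 0"
| "theta_coeff' (Kpm s) z = of_int (pm_sign s) * cos z"
| "theta_coeff' (Rpm s) z = - of_int (pm_sign s) * sin z"
| "theta_coeff' (Spm s) z = of_int (pm_sign s) * sin z"
| "theta_coeff' J3 z = 0"
| "theta_coeff' K3 z = 0"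

primrec potential' :: "generator \<Rightarrow> complex \<Rightarrow> complex \<Rightarrow> complex \<Rightarrow> complex" where
  "potential' (Jpm s) \<nu> \<mu> z = \<mu> + \<mu> * cos z * cos z * inverse (sin z) * inverse (sin z)"
| "potential' (Kpm s) \<nu> \<mu> z = - (\<nu> + (1 + of_int (pm_sign s)) / 2) * sin z"
| "potential' (Rpm s) \<nu> \<mu> z = \<mu> * cos z * inverse (sin z) * inverse (sin z) - (\<nu> + (1 + of_int (pm_sign s)) / 2) * cos z"
| "potential' (Spm s) \<nu> \<mu> z = \<mu> * cos z * inverse (sin z) * inverse (sin z) + (\<nu> + (1 + of_int (pm_sign s)) / 2) * cos z"
| "potential' J3 \<nu> \<mu> z = 0"
| "potential' K3 \<nu> \<mu> z = 0"

lemma has_field_derivative_theta_coeff: "(theta_coeff X has_field_derivative theta_coeff' X z) (at z)"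
proof -
  have "((\<lambda>z. theta_coeff X z) has_field_derivative theta_coeff' X z) (at z)"
    by (cases X) (auto intro!: derivative_eq_intros)
  then show ?thesis by simp
qed

lemma has_field_derivative_potential:
  assumes "sin z \<noteq> 0"
  shows "(potential X \<nu> \<mu> has_field_derivative potential' X \<nu> \<mu> z) (at z)"
proof -
  have "((\<lambda>z. potential X \<nu> \<mu> z) has_field_derivative potential' X \<nu> \<mu> z) (at z)"
    using assms by (cases X) (auto intro!: derivative_eq_intros simp: field_simps power2_eq_square)
  then show ?thesis by simp
qed

definition profile :: "generator \<Rightarrow> complex \<Rightarrow> complex \<Rightarrow> (real \<Rightarrow> complex) \<Rightarrow> (real \<Rightarrow> complex) \<Rightarrow> real \<Rightarrow> complex" where
  "profile X \<nu> \<mu> g g' \<theta> = theta_coeff X (of_real \<theta>) * g' \<theta> + potential X \<nu> \<mu> (of_real \<theta>) * g \<theta>"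

definition profile' ::
    "generator \<Rightarrow> complex \<Rightarrow> complex \<Rightarrow> (real \<Rightarrow> complex) \<Rightarrow> (real \<Rightarrow> complex) \<Rightarrow> (real \<Rightarrow> complex) \<Rightarrow> real \<Rightarrow> complex" where
  "profile' X \<nu> \<mu> g g' g'' \<theta> = theta_coeff' X (of_real \<theta>) * g' \<theta> + theta_coeff X (of_real \<theta>) * g'' \<theta>
     + potential' X \<nu> \<mu> (of_real \<theta>) * g \<theta> + potential X \<nu> \<mu> (of_real \<theta>) * g' \<theta>"

lemma has_vector_derivative_profile:
  assumes "0 < \<theta>" "\<theta> < pi"
    and "(g has_vector_derivative g' \<theta>) (at \<theta>)" "(g' has_vector_derivative g'' \<theta>) (at \<theta>)"
  shows "(profile X \<nu> \<mu> g g' has_vector_derivative profile' X \<nu> \<mu> g g' g'' \<theta>) (at \<theta>)"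
proof -
  have s: "sin (complex_of_real \<theta>) \<noteq> 0"
    using sin_gt_zero[OF assms(1,2)] by (simp add: sin_of_real)
  show ?thesis
    unfolding profile_def[abs_def] profile'_def
    by (rule derivative_eq_intros has_vector_derivative_mult has_vector_derivative_real_field
        has_field_derivative_theta_coeff has_field_derivative_potential[OF s] assms(3,4))+ (simp add: algebra_simps)
qed

lemma separated_partial_derivatives:
  assumes "0 < r" "(g has_vector_derivative d) (at \<theta>)"
  shows "((\<lambda>s. separated \<nu> \<mu> g (s, \<theta>, \<phi>)) has_vector_derivative \<nu> / r * separated \<nu> \<mu> g (r, \<theta>, \<phi>)) (at r)"
    "((\<lambda>s. separated \<nu> \<mu> g (r, s, \<phi>)) has_vector_derivative separated \<nu> \<mu> (\<lambda>_. d) (r, \<theta>, \<phi>)) (at \<theta>)"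
    "((\<lambda>s. separated \<nu> \<mu> g (r, \<theta>, s)) has_vector_derivative \<i> * \<mu> * separated \<nu> \<mu> g (r, \<theta>, \<phi>)) (at \<phi>)"
proof -
  have "((\<lambda>z. z powr \<nu> * g \<theta> * exp (\<i> * \<mu> * complex_of_real \<phi>)) has_field_derivative
      \<nu> / r * (of_real r powr \<nu> * g \<theta> * exp (\<i> * \<mu> * complex_of_real \<phi>))) (at (of_real r))"
    using assms(1) by (auto intro!: derivative_eq_intros simp: powr_diff)
  then show "((\<lambda>s. separated \<nu> \<mu> g (s, \<theta>, \<phi>)) has_vector_derivative \<nu> / r * separated \<nu> \<mu> g (r, \<theta>, \<phi>)) (at r)"
    unfolding separated_def split by (rule has_vector_derivative_real_field)
  have "((\<lambda>z. of_real r powr \<nu> * g \<theta> * exp (\<i> * \<mu> * z)) has_field_derivative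
      \<i> * \<mu> * (of_real r powr \<nu> * g \<theta> * exp (\<i> * \<mu> * complex_of_real \<phi>))) (at (of_real \<phi>))"
    by (auto intro!: derivative_eq_intros)
  then show "((\<lambda>s. separated \<nu> \<mu> g (r, \<theta>, s)) has_vector_derivative \<i> * \<mu> * separated \<nu> \<mu> g (r, \<theta>, \<phi>)) (at \<phi>)"
    unfolding separated_def split by (rule has_vector_derivative_real_field)
  show "((\<lambda>s. separated \<nu> \<mu> g (r, s, \<phi>)) has_vector_derivative separated \<nu> \<mu> (\<lambda>_. d) (r, \<theta>, \<phi>)) (at \<theta>)"
    unfolding separated_def split
    by (intro has_vector_derivative_mult_left has_vector_derivative_mult_right assms(2))
qed

lemma separated_partially_differentiable:
  assumes "\<And>\<theta>. 0 < \<theta> \<Longrightarrow> \<theta> < pi \<Longrightarrow> (g has_vector_derivative g' \<theta>) (at \<theta>)"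
  shows "separated \<nu> \<mu> g \<in> partially_differentiable"
  unfolding partially_differentiable_def
  using separated_partial_derivatives[OF _ assms] by (fast elim: solid_domain_iff[THEN iffD1, elim_format])

text \<open>The powers of r and the phases in front of a generator only shift the exponents, while r
  \<open>D_r\<close> and \<open>D_phi\<close> act as the scalars \<nu> and i \<mu>. What is left
  concerns the profile alone.\<close>

lemma diff_op_separated:
  assumes "\<And>\<theta>. 0 < \<theta> \<Longrightarrow> \<theta> < pi \<Longrightarrow> (g has_vector_derivative g' \<theta>) (at \<theta>)" "p \<in> solid_domain"
  shows "diff_op X (separated \<nu> \<mu> g) p =
    separated (\<nu> + of_int (fst (shift X))) (\<mu> + of_int (snd (shift X))) (profile X \<nu> \<mu> g g') p"
proof -
  obtain r \<theta> \<phi> where p: "p = (r, \<theta>, \<phi>)" "0 < r" "0 < \<theta>" "\<theta> < pi"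
    using assms(2) solid_domain_iff by (metis surj_pair)
  have s: "sin \<theta> \<noteq> 0"
    using sin_gt_zero[OF p(3,4)] by simp
  define A E where "A = complex_of_real r powr \<nu>" and "E = exp (\<i> * \<mu> * complex_of_real \<phi>)"
  have D: "D_r (separated \<nu> \<mu> g) (r, \<theta>, \<phi>) = \<nu> / r * (A * g \<theta> * E)"
    "D_theta (separated \<nu> \<mu> g) (r, \<theta>, \<phi>) = A * g' \<theta> * E"
    "D_phi (separated \<nu> \<mu> g) (r, \<theta>, \<phi>) = \<i> * \<mu> * (A * g \<theta> * E)"
    "separated \<nu> \<mu> g (r, \<theta>, \<phi>) = A * g \<theta> * E"
    using separated_partial_derivatives[OF p(2) assms(1)[OF p(3,4)], THEN vector_derivative_at, of \<nu> \<mu> \<phi>]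
    by (simp_all add: D_r_def D_theta_def D_phi_def separated_def A_def E_def)
  have pows: "complex_of_real r powr (\<nu> + 1) = A * r" "complex_of_real r powr (\<nu> - 1) = A / r"
    using p(2) by (simp_all add: powr_add powr_diff A_def)
  have exps: "exp (\<i> * (\<mu> + 1) * complex_of_real \<phi>) = E * cis \<phi>" "exp (\<i> * (\<mu> - 1) * complex_of_real \<phi>) = E * cis (- \<phi>)"
    by (simp_all add: E_def cis_conv_exp flip: exp_add) (simp_all add: algebra_simps)
  have "X \<in> {Jpm Plus, Jpm Minus, Kpm Plus, Kpm Minus, Rpm Plus, Rpm Minus, Spm Plus, Spm Minus, J3, K3}"
  proof (cases X)
    case (Jpm s) then show ?thesis by (cases s) simp_all
  next
    case (Kpm s) then show ?thesis by (cases s) simp_all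
  next
    case (Rpm s) then show ?thesis by (cases s) simp_all
  next
    case (Spm s) then show ?thesis by (cases s) simp_all
  qed simp_all
  then show ?thesis
    using p(2) s unfolding p(1)
    by (elim insertE emptyE; simp add: D profile_def separated_def[of _ _ "profile _ _ _ _ _"] pows exps euler_op_def
        A_def[symmetric] E_def[symmetric] sin_of_real cos_of_real cot_def power_int_minus; simp add: field_simps)
qed

text \<open>The derivatives are parameters, so that \<open>ODE\<close> can serve as a rewrite rule
  eliminating \<open>g''\<close>.\<close>

locale associated_Legendre =
  fixes \<nu> \<mu> :: complex and g g' g'' :: "real \<Rightarrow> complex"
  assumes first_derivative: "\<And>\<theta>. 0 < \<theta> \<Longrightarrow> \<theta> < pi \<Longrightarrow> (g has_vector_derivative g' \<theta>) (at \<theta>)"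
    and second_derivative: "\<And>\<theta>. 0 < \<theta> \<Longrightarrow> \<theta> < pi \<Longrightarrow> (g' has_vector_derivative g'' \<theta>) (at \<theta>)"
    and ODE: "\<And>\<theta>. 0 < \<theta> \<Longrightarrow> \<theta> < pi \<Longrightarrow> g'' \<theta> = - complex_of_real (cos \<theta>) * inverse (complex_of_real (sin \<theta>)) * g' \<theta>
      - (\<nu> * (\<nu> + 1) - \<mu> * \<mu> * inverse (complex_of_real (sin \<theta>)) * inverse (complex_of_real (sin \<theta>))) * g \<theta>"
begin

definition second_profile :: "generator \<Rightarrow> generator \<Rightarrow> real \<Rightarrow> complex" where
  "second_profile Y X = profile Y (\<nu> + of_int (fst (shift X))) (\<mu> + of_int (snd (shift X)))
     (profile X \<nu> \<mu> g g') (profile' X \<nu> \<mu> g g' g'')"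

sublocale local_representation diff_op solid_domain partially_differentiable
  by (rule local_representation_diff_op)

lemma diff_op_diff_op_separated:
  assumes "p \<in> solid_domain"
  shows "diff_op Y (diff_op X (separated \<nu> \<mu> g)) p =
    separated (\<nu> + of_int (fst (shift X) + fst (shift Y))) (\<mu> + of_int (snd (shift X) + snd (shift Y))) (second_profile Y X) p"
proof -
  have "diff_op Y (diff_op X (separated \<nu> \<mu> g)) p =
      diff_op Y (separated (\<nu> + of_int (fst (shift X))) (\<mu> + of_int (snd (shift X))) (profile X \<nu> \<mu> g g')) p"
    \<comment> \<open>The formula for the inner generator holds on the domain only; locality carries
      it under the outer one.\<close>
    by (rule rho_cong[OF assms diff_op_separated[OF first_derivative]])
  also have "\<dots> = separated (\<nu> + of_int (fst (shift X)) + of_int (fst (shift Y)))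
      (\<mu> + of_int (snd (shift X)) + of_int (snd (shift Y))) (second_profile Y X) p"
    unfolding second_profile_def
    by (rule diff_op_separated[OF has_vector_derivative_profile assms]) (auto intro: first_derivative second_derivative)
  finally show ?thesis
    by (simp add: add.assoc)
qed

lemma separated_in_D2: "separated \<nu> \<mu> g \<in> D2"
proof -
  have "separated \<nu> \<mu> g \<in> partially_differentiable"
    by (rule separated_partially_differentiable[OF first_derivative])
  moreover have "diff_op X (separated \<nu> \<mu> g) \<in> partially_differentiable" for X
  proof (rule cong_in)
    show "separated (\<nu> + of_int (fst (shift X))) (\<mu> + of_int (snd (shift X))) (profile X \<nu> \<mu> g g')
        \<in> partially_differentiable"
      by (rule separated_partially_differentiable[OF has_vector_derivative_profile])
        (auto intro: first_derivative second_derivative)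
  qed (simp add: diff_op_separated[OF first_derivative])
  ultimately show ?thesis
    by (simp add: D2_def)
qed

text \<open>With \<open>g''\<close> eliminated, both sides are linear in \<open>g\<close> and
  \<open>g'\<close>, with coefficients polynomial in \<nu>, \<mu>, sin, cos and the inverse of sin.
  Trigonometry settles the comparison of coefficients.\<close>

lemma second_profile_relations:
  assumes "0 < \<theta>" "\<theta> < pi"
  defines "A \<equiv> \<lambda>X Y. second_profile X Y \<theta> + second_profile Y X \<theta>"
  shows "2 * A (Kpm Plus) J3 = A (Rpm Plus) (Jpm Minus) - A (Spm Plus) (Jpm Plus)"
    "2 * A (Kpm Minus) J3 = A (Rpm Minus) (Jpm Plus) - A (Spm Minus) (Jpm Minus)"
    "2 * A (Jpm Plus) K3 = A (Rpm Plus) (Kpm Minus) + A (Spm Minus) (Kpm Plus)"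
    "2 * A (Jpm Minus) K3 = A (Rpm Minus) (Kpm Plus) + A (Spm Plus) (Kpm Minus)"
    "4 * A J3 K3 = A (Rpm Plus) (Rpm Minus) - A (Spm Plus) (Spm Minus)"
    "second_profile K3 K3 \<theta> + second_profile J3 J3 \<theta> + A (Jpm Plus) (Jpm Minus) / 2 - A (Kpm Plus) (Kpm Minus) / 2
      - A (Rpm Plus) (Rpm Minus) / 4 - A (Spm Plus) (Spm Minus) / 4 = - 5/4 * g \<theta>"
proof -
  define s c k where "s = sin (complex_of_real \<theta>)" and "c = cos (complex_of_real \<theta>)" and "k = inverse s"
  have "s \<noteq> 0"
    using sin_gt_zero[OF assms(1,2)] by (simp add: s_def sin_of_real)
  then have k: "k * s = 1"
    by (simp add: k_def)
  have c: "c * c = 1 - s * s"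
    using sin_cos_squared_add[of "complex_of_real \<theta>"] by (simp add: s_def c_def power2_eq_square algebra_simps)
  have g'': "g'' \<theta> = - c * k * g' \<theta> - (\<nu> * (\<nu> + 1) - \<mu> * \<mu> * k * k) * g \<theta>"
    using ODE[OF assms(1,2)] by (simp add: s_def c_def k_def sin_of_real cos_of_real)
  txt \<open>Oriented as a Groebner basis of the ideal of \<open>k s = 1\<close>, \<open>c\<^sup>2 + s\<^sup>2 = 1\<close>, so that
    simplification decides the polynomial identities below.\<close>
  have reduce: "k * s = 1" "k * (s * x) = x" "c * c = 1 - s * s" "c * (c * x) = x - s * (s * x)" for x
  proof -
    have "k * (s * x) = (k * s) * x" "c * (c * x) = (c * c) * x"
      by (simp_all only: mult.assoc)
    then show "k * (s * x) = x" "c * (c * x) = x - s * (s * x)"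
      unfolding k c by (simp_all add: algebra_simps)
  qed (fact k c)+
  note defs = A_def second_profile_def profile_def profile'_def s_def[symmetric] c_def[symmetric] k_def[symmetric] g''
  show "2 * A (Kpm Plus) J3 = A (Rpm Plus) (Jpm Minus) - A (Spm Plus) (Jpm Plus)"
    by (simp add: defs; simp add: algebra_simps reduce)
  show "2 * A (Kpm Minus) J3 = A (Rpm Minus) (Jpm Plus) - A (Spm Minus) (Jpm Minus)"
    by (simp add: defs; simp add: algebra_simps reduce)
  show "2 * A (Jpm Plus) K3 = A (Rpm Plus) (Kpm Minus) + A (Spm Minus) (Kpm Plus)"
    by (simp add: defs; simp add: algebra_simps reduce)
  show "2 * A (Jpm Minus) K3 = A (Rpm Minus) (Kpm Plus) + A (Spm Plus) (Kpm Minus)"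
    by (simp add: defs; simp add: algebra_simps reduce)
  show "4 * A J3 K3 = A (Rpm Plus) (Rpm Minus) - A (Spm Plus) (Spm Minus)"
    by (simp add: defs; simp add: algebra_simps reduce)
  show "second_profile K3 K3 \<theta> + second_profile J3 J3 \<theta> + A (Jpm Plus) (Jpm Minus) / 2 - A (Kpm Plus) (Kpm Minus) / 2
      - A (Rpm Plus) (Rpm Minus) / 4 - A (Spm Plus) (Spm Minus) / 4 = - 5/4 * g \<theta>"
    by (simp add: defs; simp add: algebra_simps add_divide_distrib diff_divide_distrib reduce)
qed

lemma singleton_relations_separated:
  assumes "p \<in> solid_domain"
  shows "singleton_relations (separated \<nu> \<mu> g) p"
proof -
  obtain r \<theta> \<phi> where p: "p = (r, \<theta>, \<phi>)" "0 < \<theta>" "\<theta> < pi"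
    using assms solid_domain_iff by (metis surj_pair)
  \<comment> \<open>All products in one relation share the total shift, hence this factor, and the
    profile identity is simply multiplied by it.\<close>
  define W where "W i j = complex_of_real r powr (\<nu> + of_int i) * exp (\<i> * (\<mu> + of_int j) * complex_of_real \<phi>)" for i j
  have W: "diff_op Y (diff_op X (separated \<nu> \<mu> g)) p =
      W (fst (shift X) + fst (shift Y)) (snd (shift X) + snd (shift Y)) * second_profile Y X \<theta>" for X Y
    unfolding diff_op_diff_op_separated[OF assms] by (simp add: separated_def p(1) W_def)
  have W0: "separated \<nu> \<mu> g p = W 0 0 * g \<theta>"
    by (simp add: separated_def p(1) W_def)
  note rel = second_profile_relations[OF p(2,3)]
  show ?thesis
    unfolding singleton_relations_def anticomm_def W W0
    using rel(1)[THEN arg_cong[where f = "(*) (W 1 0)"]] rel(2)[THEN arg_cong[where f = "(*) (W (-1) 0)"]]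
      rel(3)[THEN arg_cong[where f = "(*) (W 0 1)"]] rel(4)[THEN arg_cong[where f = "(*) (W 0 (-1))"]]
      rel(5)[THEN arg_cong[where f = "(*) (W 0 0)"]] rel(6)[THEN arg_cong[where f = "(*) (W 0 0)"]]
    by (simp add: algebra_simps add_divide_distrib)
qed

end

subsection \<open>The regularized hypergeometric function and Ferrers functions\<close>

text \<open>Since Gamma(c) (c)_n = Gamma(c + n), the normalization and the denominator of the series
  merge into \<open>rGamma\<close>, which has no poles.\<close>

definition reg_coeff :: "complex \<Rightarrow> complex \<Rightarrow> complex \<Rightarrow> nat \<Rightarrow> complex" where
  "reg_coeff a b c n = pochhammer a n * pochhammer b n * rGamma (c + of_nat n) / fact n"

text \<open>The regularized function \<open>2F1(a, b; c; z) / \<Gamma>(c)\<close>. It is entire in \<open>c\<close>, which makes the limit in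
  \<^const>\<open>ferrersP\<close> at positive integers \<open>\<mu> = 1 - c\<close> a plain evaluation.\<close>

definition reg_hyp :: "complex \<Rightarrow> complex \<Rightarrow> complex \<Rightarrow> complex \<Rightarrow> complex" where
  "reg_hyp a b c z = (\<Sum>n. reg_coeff a b c n * z ^ n)"

text \<open>Rests on the functional equation of \<open>rGamma\<close>, so it survives at c + n = 0,
  where a quotient of coefficients would make no sense. It drives both the convergence bound and the
  differential equation.\<close>

lemma reg_coeff_rec:
  "of_nat (Suc n) * (c + of_nat n) * reg_coeff a b c (Suc n) = (a + of_nat n) * (b + of_nat n) * reg_coeff a b c n"
proof -
  have "rGamma (c + of_nat n) = (c + of_nat n) * rGamma (c + of_nat (Suc n))"
    using rGamma_plus1[of "c + of_nat n"] by (simp add: add_ac)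
  then show ?thesis
    by (simp add: reg_coeff_def pochhammer_Suc divide_simps del: of_nat_Suc)
qed

text \<open>A ratio test uniform in \<open>c\<close>: \<open>N\<close> and \<open>q\<close> depend
  on \<open>c\<close> only through the bound \<open>C\<close>, which is what passing to a limit in
  \<open>c\<close> requires.\<close>

lemma reg_coeff_geometric_bound:
  assumes "norm z < 1"
  obtains N q where "0 < q" "q < 1"
    "\<And>c n. norm c \<le> C \<Longrightarrow> norm (reg_coeff a b c (N + n) * z ^ (N + n)) \<le> norm (reg_coeff a b c N * z ^ N) * q ^ n"
proof -
  define q where "q = (norm z + 1) / 2"
  have q: "0 < q" "q < 1" "norm z < q"
    using assms by (auto simp: q_def intro: add_nonneg_pos)
  \<comment> \<open>Both sides are quadratic in n, with leading coefficients \<open>norm z\<close>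
    and \<open>q\<close>.\<close>
  have "eventually (\<lambda>n. (norm a + real n) * (norm b + real n) * norm z \<le> q * (real n + 1) * (real n - C)) at_top"
    using q(3) by real_asymp
  then have "eventually (\<lambda>n. (norm a + real n) * (norm b + real n) * norm z \<le> q * (real n + 1) * (real n - C) \<and> C < real n) at_top"
    by (intro eventually_conj) (auto, real_asymp)
  then obtain N where N: "\<And>n. n \<ge> N \<Longrightarrow> (norm a + real n) * (norm b + real n) * norm z \<le> q * (real n + 1) * (real n - C)"
     "\<And>n. n \<ge> N \<Longrightarrow> C < real n"
    by (auto simp: eventually_at_top_linorder)
  have step: "norm (reg_coeff a b c (Suc n) * z ^ Suc n) \<le> q * norm (reg_coeff a b c n * z ^ n)"
    if "n \<ge> N" "norm c \<le> C" for c n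
  proof -
    let ?t = "norm (reg_coeff a b c n)" and ?s = "norm (reg_coeff a b c (Suc n))"
    \<comment> \<open>This keeps c + n away from 0, so the recurrence can be divided.\<close>
    have pos: "0 < real n - C" using N(2)[OF that(1)] by simp
    have cn: "real n - C \<le> norm (c + of_nat n)"
      using norm_diff_ineq[of "of_nat n" c] that(2) by (simp add: add.commute)
    have "(real n + 1) * (real n - C) * (?s * norm z) \<le> (real n + 1) * norm (c + of_nat n) * (?s * norm z)"
      using cn by (intro mult_right_mono mult_left_mono) auto
    also have "\<dots> = norm (of_nat (Suc n) * (c + of_nat n) * reg_coeff a b c (Suc n)) * norm z"
      by (simp add: norm_mult add.commute del: of_nat_Suc)
    also have "\<dots> = norm (a + of_nat n) * norm (b + of_nat n) * norm z * ?t"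
      unfolding reg_coeff_rec by (simp add: norm_mult)
    also have "\<dots> \<le> (norm a + real n) * (norm b + real n) * norm z * ?t"
      using norm_triangle_ineq[of a "of_nat n"] norm_triangle_ineq[of b "of_nat n"]
      by (intro mult_right_mono mult_mono) auto
    also have "\<dots> \<le> q * (real n + 1) * (real n - C) * ?t"
      using N(1)[OF that(1)] by (intro mult_right_mono) auto
    finally have "((real n + 1) * (real n - C)) * (?s * norm z) \<le> ((real n + 1) * (real n - C)) * (q * ?t)"
      by (simp add: mult_ac)
    then have "?s * norm z \<le> q * ?t"
      using pos by (subst (asm) mult_le_cancel_left_pos) auto
    then have "?s * norm z * norm z ^ n \<le> q * ?t * norm z ^ n"
      by (intro mult_right_mono) auto
    then show ?thesis
      by (simp add: norm_mult norm_power mult_ac)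
  qed
  have "norm (reg_coeff a b c (N + n) * z ^ (N + n)) \<le> norm (reg_coeff a b c N * z ^ N) * q ^ n"
    if "norm c \<le> C" for c n
  proof (induction n)
    case (Suc n)
    have "norm (reg_coeff a b c (N + Suc n) * z ^ (N + Suc n)) \<le> q * norm (reg_coeff a b c (N + n) * z ^ (N + n))"
      using step[of "N + n" c] that by simp
    also have "\<dots> \<le> q * (norm (reg_coeff a b c N * z ^ N) * q ^ n)"
      using Suc q by (intro mult_left_mono) auto
    finally show ?case by (simp add: mult_ac)
  qed simp
  then show thesis
    using that q by blast
qed

lemma summable_reg_coeff:
  assumes "norm z < 1"
  shows "summable (\<lambda>n. reg_coeff a b c n * z ^ n)"
proof -
  obtain N q where q: "0 < q" "q < 1"
    "\<And>c' n. norm c' \<le> norm c \<Longrightarrow> norm (reg_coeff a b c' (N + n) * z ^ (N + n)) \<le> norm (reg_coeff a b c' N * z ^ N) * q ^ n"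
    using reg_coeff_geometric_bound[OF assms] by metis
  have "summable (\<lambda>n. norm (reg_coeff a b c N * z ^ N) * q ^ n)"
    using q by (intro summable_mult summable_geometric) auto
  then have "summable (\<lambda>n. reg_coeff a b c (N + n) * z ^ (N + n))"
    by (rule summable_comparison_test') (use q(3)[of c] in auto)
  then show ?thesis
    using summable_iff_shift[of "\<lambda>n. reg_coeff a b c n * z ^ n" N] by (simp add: add.commute)
qed

text \<open>Tannery's theorem handles the tail from index \<open>N\<close>, where the geometric
  bound begins; the finitely many earlier terms are continuous in \<open>c\<close>.\<close>

lemma tendsto_reg_hyp:
  assumes "norm z < 1"
  shows "((\<lambda>c. reg_hyp a b c z) \<longlongrightarrow> reg_hyp a b c0 z) (at c0)"
proof -
  define t where "t c n = reg_coeff a b c n * z ^ n" for c n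
  obtain N q where q: "0 < q" "q < 1"
    "\<And>c n. norm c \<le> norm c0 + 1 \<Longrightarrow> norm (t c (N + n)) \<le> norm (t c N) * q ^ n"
    unfolding t_def using reg_coeff_geometric_bound[OF assms] by metis
  have lim: "((\<lambda>c. t c n) \<longlongrightarrow> t c0 n) (at c0)" for n
  proof -
    have "isCont (\<lambda>c. rGamma (c + of_nat n)) c0"
      by (intro continuous_intros)
    then show ?thesis
      unfolding t_def reg_coeff_def isCont_def by (intro tendsto_intros) auto
  qed
  \<comment> \<open>The bound still contains \<open>norm (t c N)\<close>. Continuity replaces it
    near \<open>c0\<close> by a constant, as domination requires.\<close>
  have "eventually (\<lambda>c. norm (t c N) < norm (t c0 N) + 1) (at c0)"
    using tendsto_norm[OF lim[of N]] by (rule order_tendstoD) simp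
  moreover have "eventually (\<lambda>c. norm c < norm c0 + 1) (at c0)"
    using tendsto_norm[OF tendsto_ident_at] by (rule order_tendstoD) simp
  ultimately have bound: "eventually (\<lambda>c. \<forall>n. norm (t c (n + N)) \<le> (norm (t c0 N) + 1) * q ^ n) (at c0)"
  proof eventually_elim
    case (elim c)
    show ?case
    proof
      fix n
      have "norm (t c (n + N)) \<le> norm (t c N) * q ^ n"
        using q(3)[of c n] elim by (simp add: add.commute)
      also have "\<dots> \<le> (norm (t c0 N) + 1) * q ^ n"
        using elim q by (intro mult_right_mono) auto
      finally show "norm (t c (n + N)) \<le> (norm (t c0 N) + 1) * q ^ n" .
    qed
  qed
  have "eventually (\<lambda>(n, c). norm (t c (n + N)) \<le> (norm (t c0 N) + 1) * q ^ n) (at_top \<times>\<^sub>F at c0)"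
    by (rule eventually_mono[OF eventually_prodI[OF always_eventually bound]]) auto
  then have tail: "((\<lambda>c. \<Sum>n. t c (n + N)) \<longlongrightarrow> (\<Sum>n. t c0 (n + N))) (at c0)"
    using tannerys_theorem[of "\<lambda>n c. t c (n + N)" "\<lambda>n. t c0 (n + N)" "at c0" "\<lambda>n. (norm (t c0 N) + 1) * q ^ n"]
      lim q by (auto intro!: summable_mult summable_geometric)
  have "reg_hyp a b c z = (\<Sum>n. t c (n + N)) + (\<Sum>n<N. t c n)" for c
    unfolding reg_hyp_def t_def by (rule suminf_split_initial_segment[OF summable_reg_coeff[OF assms]])
  then show ?thesis
    using tendsto_add[OF tail tendsto_sum[of "{..<N}" "\<lambda>n c. t c n", OF lim]] by simp
qed

lemma hyp2F1_eq_reg_hyp: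
  assumes "c \<notin> \<int>\<^sub>\<le>\<^sub>0" "norm z < 1"
  shows "1 / Gamma c * hyp2F1 a b c z = reg_hyp a b c z"
proof -
  have G: "Gamma c \<noteq> 0"
    using assms(1) by (simp add: Gamma_eq_zero_iff)
  have "fps_nth (fps_hypergeo [a, b] [c] 1) n * z ^ n = Gamma c * (reg_coeff a b c n * z ^ n)" for n
  proof -
    have "pochhammer c n \<noteq> 0"
      using assms(1) by (auto simp: pochhammer_eq_0_iff)
    moreover have "Gamma c * (pochhammer c n * rGamma (c + of_nat n)) = 1"
      unfolding pochhammer_rGamma[of c n, symmetric] using G by (simp add: rGamma_inverse_Gamma)
    ultimately have "rGamma (c + of_nat n) = 1 / (Gamma c * pochhammer c n)"
      using G by (simp add: field_simps)
    with \<open>pochhammer c n \<noteq> 0\<close> G show ?thesis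
      by (simp add: reg_coeff_def field_simps)
  qed
  then have "hyp2F1 a b c z = Gamma c * reg_hyp a b c z"
    unfolding hyp2F1_def eval_fps_def reg_hyp_def
    by (simp only: suminf_mult[OF summable_reg_coeff[OF assms(2)]])
  then show ?thesis
    using G by simp
qed

text \<open>Compare coefficients: z F'' + c F' contributes (n + c)(n + 1) t_(n+1), the other terms
  contribute -(a + n)(b + n) t_n, and these cancel by \<open>reg_coeff_rec\<close>.\<close>

lemma reg_hyp_ODE:
  obtains F' F'' where
    "\<And>z. norm z < 1 \<Longrightarrow> (reg_hyp a b c has_field_derivative F' z) (at z)"
    "\<And>z. norm z < 1 \<Longrightarrow> (F' has_field_derivative F'' z) (at z)"
    "\<And>z. norm z < 1 \<Longrightarrow> z * (1 - z) * F'' z + (c - (a + b + 1) * z) * F' z - a * b * reg_hyp a b c z = 0"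
proof -
  define t where "t = reg_coeff a b c"
  define F' where "F' z = (\<Sum>n. diffs t n * z ^ n)" for z
  define F'' where "F'' z = (\<Sum>n. diffs (diffs t) n * z ^ n)" for z
  have s0: "summable (\<lambda>n. t n * z ^ n)" if "norm z < 1" for z
    unfolding t_def by (rule summable_reg_coeff[OF that])
  have s1: "summable (\<lambda>n. diffs t n * z ^ n)" if "norm z < 1" for z
    by (rule termdiff_converges[OF that s0])
  have s2: "summable (\<lambda>n. diffs (diffs t) n * z ^ n)" if "norm z < 1" for z
    by (rule termdiff_converges[OF that s1])
  have d0: "(reg_hyp a b c has_field_derivative F' z) (at z)" if "norm z < 1" for z
    using termdiffs_strong'[OF s0 that] unfolding F'_def reg_hyp_def t_def .
  have d1: "(F' has_field_derivative F'' z) (at z)" if "norm z < 1" for z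
    using termdiffs_strong'[OF s1 that] unfolding F'_def F''_def .
  have ode: "z * (1 - z) * F'' z + (c - (a + b + 1) * z) * F' z - a * b * reg_hyp a b c z = 0"
    if z: "norm z < 1" for z
  proof -
    have shift: "(\<lambda>n. of_nat n * u n * z ^ n) sums (z * S)"
      if "(\<lambda>n. of_nat n * u n * z ^ (n - Suc 0)) sums S" for u S
    proof -
      have "z * (of_nat n * u n * z ^ (n - Suc 0)) = of_nat n * u n * z ^ n" for n
        by (cases n) auto
      then show ?thesis
        using sums_mult[OF that, of z] by (simp only:)
    qed
    have F: "(\<lambda>n. t n * z ^ n) sums reg_hyp a b c z"
      using s0[OF z] unfolding reg_hyp_def t_def by (rule summable_sums)
    have F1: "(\<lambda>n. diffs t n * z ^ n) sums F' z"
      unfolding F'_def by (rule summable_sums[OF s1[OF z]])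
    have zF1: "(\<lambda>n. of_nat n * t n * z ^ n) sums (z * F' z)"
      unfolding F'_def by (rule shift[OF diffs_equiv[OF s1[OF z]]])
    have zF2: "(\<lambda>n. of_nat n * diffs t n * z ^ n) sums (z * F'' z)"
      unfolding F''_def by (rule shift[OF diffs_equiv[OF s2[OF z]]])
    \<comment> \<open>This is the series of z^2 F''. Truncated subtraction at n = 0 is harmless
      because of the factor n, and it permits the index shift.\<close>
    have "(\<lambda>n. of_nat (n - 1) * (of_nat n * t n) * z ^ n) sums (z * (z * F'' z))"
    proof -
      have "(\<lambda>n. of_nat (Suc n - 1) * (of_nat (Suc n) * t (Suc n)) * z ^ Suc n) sums (z * (z * F'' z))"
        using sums_mult[OF zF2, of z] by (simp add: diffs_def mult_ac)
      then show ?thesis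
        using sums_Suc_iff[of "\<lambda>n. of_nat (n - 1) * (of_nat n * t n) * z ^ n"] by simp
    qed
    from sums_diff[OF sums_diff[OF sums_add[OF zF2 sums_mult[OF F1, of c]]
        sums_add[OF this sums_mult[OF zF1, of "a + b + 1"]]] sums_mult[OF F, of "a * b"]]
    have "(\<lambda>n. of_nat n * diffs t n * z ^ n + c * (diffs t n * z ^ n)
          - (of_nat (n - 1) * (of_nat n * t n) * z ^ n + (a + b + 1) * (of_nat n * t n * z ^ n))
          - a * b * (t n * z ^ n)) sums
        (z * F'' z + c * F' z - (z * (z * F'' z) + (a + b + 1) * (z * F' z)) - a * b * reg_hyp a b c z)" .
    moreover have "of_nat n * diffs t n * z ^ n + c * (diffs t n * z ^ n)
          - (of_nat (n - 1) * (of_nat n * t n) * z ^ n + (a + b + 1) * (of_nat n * t n * z ^ n))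
          - a * b * (t n * z ^ n) = 0" for n
    proof -
      have 1: "of_nat (n - 1) * of_nat n = (of_nat n * of_nat n - of_nat n :: complex)"
        by (cases n) (auto simp: algebra_simps)
      have 2: "(of_nat n + c) * diffs t n = (a + of_nat n) * (b + of_nat n) * t n"
        using reg_coeff_rec[of n c a b] by (simp add: t_def diffs_def mult_ac add.commute)
      have "of_nat n * diffs t n * z ^ n + c * (diffs t n * z ^ n)
          - (of_nat (n - 1) * (of_nat n * t n) * z ^ n + (a + b + 1) * (of_nat n * t n * z ^ n))
          - a * b * (t n * z ^ n)
          = ((of_nat n + c) * diffs t n - (of_nat (n - 1) * of_nat n + (a + b + 1) * of_nat n + a * b) * t n) * z ^ n"
        by (simp add: algebra_simps)
      also have "\<dots> = 0"
        unfolding 1 2 by (simp add: algebra_simps)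
      finally show ?thesis .
    qed
    ultimately have "(\<lambda>n. 0) sums (z * F'' z + c * F' z - (z * (z * F'' z) + (a + b + 1) * (z * F' z)) - a * b * reg_hyp a b c z)"
      by simp
    then have "z * F'' z + c * F' z - (z * (z * F'' z) + (a + b + 1) * (z * F' z)) - a * b * reg_hyp a b c z = 0"
      by (rule sums_unique2[OF _ sums_zero])
    then show ?thesis
      by (simp add: algebra_simps)
  qed
  from that[OF d0 d1 ode] show thesis .
qed

lemma ferrersP_eq_reg_hyp:
  assumes "z \<in> {-1<..<1}"
  shows "ferrersP \<nu> \<mu> z = complex_of_real ((1 + z) / (1 - z)) powr (\<mu> / 2)
    * reg_hyp (- \<nu>) (\<nu> + 1) (1 - \<mu>) (complex_of_real ((1 - z) / 2))"
proof -
  define w where "w = complex_of_real ((1 - z) / 2)"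
  have w: "norm w < 1"
    using assms unfolding w_def norm_of_real by auto
  define P where "P \<mu>' = complex_of_real ((1 + z) / (1 - z)) powr (\<mu>' / 2) * reg_hyp (- \<nu>) (\<nu> + 1) (1 - \<mu>') w" for \<mu>'
  have generic: "ferrersP_generic \<nu> \<mu>' z = P \<mu>'" if "\<not> (\<exists>k::nat. 1 \<le> k \<and> \<mu>' = of_nat k)" for \<mu>'
  proof -
    have "1 - \<mu>' \<notin> \<int>\<^sub>\<le>\<^sub>0"
    proof
      assume "1 - \<mu>' \<in> \<int>\<^sub>\<le>\<^sub>0"
      then obtain n where "1 - \<mu>' = - of_nat n"
        by (elim nonpos_Ints_cases')
      then have "\<mu>' = of_nat (Suc n)"
        by (simp add: algebra_simps)
      then show False
        using that by (metis One_nat_def Suc_leI zero_less_Suc)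
    qed
    note eq = hyp2F1_eq_reg_hyp[OF this w]
    show ?thesis
      unfolding ferrersP_generic_def P_def w_def[symmetric] eq[symmetric] by (simp only: mult_ac)
  qed
  have "Lim (at \<mu>) (\<lambda>\<mu>'. ferrersP_generic \<nu> \<mu>' z) = P \<mu>"
  proof (rule tendsto_Lim)
    have "((\<lambda>\<mu>'. reg_hyp (- \<nu>) (\<nu> + 1) (1 - \<mu>') w) \<longlongrightarrow> reg_hyp (- \<nu>) (\<nu> + 1) (1 - \<mu>) w) (at \<mu>)"
      by (rule isCont_tendsto_compose[of _ "\<lambda>c. reg_hyp (- \<nu>) (\<nu> + 1) c w"])
        (auto simp: isCont_def intro!: tendsto_reg_hyp[OF w] tendsto_intros)
    moreover have "complex_of_real ((1 + z) / (1 - z)) \<notin> \<real>\<^sub>\<le>\<^sub>0"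
      using assms by (subst nonpos_Reals_of_real_iff) (simp add: not_le)
    ultimately have "(P \<longlongrightarrow> P \<mu>) (at \<mu>)"
      unfolding P_def by (intro tendsto_intros) (auto simp del: of_real_divide of_real_add of_real_diff)
    moreover have "eventually (\<lambda>\<mu>'. ferrersP_generic \<nu> \<mu>' z = P \<mu>') (at \<mu>)"
    proof -
      \<comment> \<open>The natural numbers are isolated, so orders close to but different from
        \<mu> are generic, which is all the limit sees.\<close>
      have "closed (\<nat> - {\<mu>})"
        by (rule closed_subset_Ints) (auto simp: Nats_subset_Ints[THEN subsetD])
      then have "open (- (\<nat> - {\<mu>}))" "\<mu> \<in> - (\<nat> - {\<mu>})"
        using open_Compl by blast+
      moreover have "ferrersP_generic \<nu> x z = P x" if "x \<in> - (\<nat> - {\<mu>})" "x \<noteq> \<mu>" for x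
        using that by (intro generic) auto
      ultimately show ?thesis
        unfolding eventually_at_topological by blast
    qed
    ultimately show "((\<lambda>\<mu>'. ferrersP_generic \<nu> \<mu>' z) \<longlongrightarrow> P \<mu>) (at \<mu>)"
      by (simp add: tendsto_cong)
  qed auto
  then show ?thesis
    using generic unfolding ferrersP_def P_def w_def by auto
qed

section \<open>The Legendre equation for Ferrers functions\<close>

lemma solid_harmonic_eq_separated: "solid_harmonic \<nu> \<mu> = separated \<nu> \<mu> (\<lambda>\<theta>. ferrersP \<nu> \<mu> (cos \<theta>))"
  by (simp add: solid_harmonic_def separated_def)

text \<open>Here x = sin^2(\<theta>/2), and q is cot(\<theta>/2) to the power \<mu>, with
  logarithmic derivative -\<mu> / sin \<theta>. Conjugating the hypergeometric equation by q
  produces the term \<mu>^2 / sin^2 \<theta> of the Legendre equation.\<close>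

lemma associated_Legendre_ferrersP:
  obtains g' g'' where "associated_Legendre \<nu> \<mu> (\<lambda>\<theta>. ferrersP \<nu> \<mu> (cos \<theta>)) g' g''"
proof -
  obtain F' F'' where F:
    "\<And>z. norm z < 1 \<Longrightarrow> (reg_hyp (- \<nu>) (\<nu> + 1) (1 - \<mu>) has_field_derivative F' z) (at z)"
    "\<And>z. norm z < 1 \<Longrightarrow> (F' has_field_derivative F'' z) (at z)"
    "\<And>z. norm z < 1 \<Longrightarrow> z * (1 - z) * F'' z + (1 - \<mu> - (- \<nu> + (\<nu> + 1) + 1) * z) * F' z
        - - \<nu> * (\<nu> + 1) * reg_hyp (- \<nu>) (\<nu> + 1) (1 - \<mu>) z = 0"
    by (rule reg_hyp_ODE[of "- \<nu>" "\<nu> + 1" "1 - \<mu>"]) blast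
  define x where "x \<theta> = complex_of_real ((1 - cos \<theta>) / 2)" for \<theta>
  define q where "q \<theta> = complex_of_real ((1 + cos \<theta>) / (1 - cos \<theta>)) powr (\<mu> / 2)" for \<theta>
  define h where "h \<theta> = reg_hyp (- \<nu>) (\<nu> + 1) (1 - \<mu>) (x \<theta>)" for \<theta>
  define h' where "h' \<theta> = F' (x \<theta>) * (sin \<theta> / 2)" for \<theta>
  define h'' where "h'' \<theta> = F'' (x \<theta>) * (sin \<theta> / 2) * (sin \<theta> / 2) + F' (x \<theta>) * (cos \<theta> / 2)" for \<theta>
  define k where "k \<theta> = complex_of_real (inverse (sin \<theta>))" for \<theta>
  \<comment> \<open>The two derivatives of q h, computed from q' = -\<mu> k q and k' =
    -cos(\<theta>) k^2.\<close>
  define g' where "g' \<theta> = q \<theta> * (h' \<theta> - \<mu> * k \<theta> * h \<theta>)" for \<theta>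
  define g'' where "g'' \<theta> = q \<theta> * (h'' \<theta> - 2 * \<mu> * k \<theta> * h' \<theta>
      + (\<mu> * \<mu> + \<mu> * cos \<theta>) * k \<theta> * k \<theta> * h \<theta>)" for \<theta>
  have g: "ferrersP \<nu> \<mu> (cos \<theta>) = q \<theta> * h \<theta>" if "0 < \<theta>" "\<theta> < pi" for \<theta>
  proof -
    have "cos \<theta> < 1" "-1 < cos \<theta>"
      using cos_monotone_0_pi[of 0 \<theta>] cos_monotone_0_pi[of \<theta> pi] that by auto
    then show ?thesis
      by (subst ferrersP_eq_reg_hyp) (auto simp: q_def h_def x_def)
  qed
  have dh: "(h has_vector_derivative h' \<theta>) (at \<theta>)" and dh': "(h' has_vector_derivative h'' \<theta>) (at \<theta>)"
    and dq: "(q has_vector_derivative - \<mu> * k \<theta> * q \<theta>) (at \<theta>)"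
    and dk: "(k has_vector_derivative - complex_of_real (cos \<theta>) * k \<theta> * k \<theta>) (at \<theta>)"
    and x: "norm (x \<theta>) < 1" and s: "sin \<theta> \<noteq> 0"
    if "0 < \<theta>" "\<theta> < pi" for \<theta>
  proof -
    have c: "cos \<theta> < 1" "-1 < cos \<theta>"
      using cos_monotone_0_pi[of 0 \<theta>] cos_monotone_0_pi[of \<theta> pi] that by auto
    show s: "sin \<theta> \<noteq> 0"
      using sin_gt_zero[OF that] by simp
    show x: "norm (x \<theta>) < 1"
      using c unfolding x_def norm_of_real by auto
    have dx: "(x has_vector_derivative of_real (sin \<theta> / 2)) (at \<theta>)"
      unfolding x_def by (rule has_vector_derivative_of_real) (auto intro!: derivative_eq_intros simp flip: has_real_derivative_iff_has_vector_derivative)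
    show "(h has_vector_derivative h' \<theta>) (at \<theta>)"
      using field_vector_diff_chain_at[OF dx F(1)[OF x]] by (simp add: h_def[abs_def] h'_def o_def mult_ac)
    have dF': "((\<lambda>\<theta>. F' (x \<theta>)) has_vector_derivative F'' (x \<theta>) * (sin \<theta> / 2)) (at \<theta>)"
      using field_vector_diff_chain_at[OF dx F(2)[OF x]] by (simp add: o_def mult_ac)
    have ds: "((\<lambda>\<theta>. complex_of_real (sin \<theta> / 2)) has_vector_derivative of_real (cos \<theta> / 2)) (at \<theta>)"
      by (rule has_vector_derivative_of_real) (auto intro!: derivative_eq_intros simp flip: has_real_derivative_iff_has_vector_derivative)
    show "(h' has_vector_derivative h'' \<theta>) (at \<theta>)"
      using has_vector_derivative_mult[OF dF' ds] by (simp add: h'_def[abs_def] h''_def algebra_simps)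
    have "((\<lambda>\<theta>. inverse (sin \<theta>)) has_real_derivative - cos \<theta> * inverse (sin \<theta>) * inverse (sin \<theta>)) (at \<theta>)"
      using s by (auto intro!: derivative_eq_intros)
    then have "((\<lambda>\<theta>. complex_of_real (inverse (sin \<theta>))) has_vector_derivative
        of_real (- cos \<theta> * inverse (sin \<theta>) * inverse (sin \<theta>))) (at \<theta>)"
      by (rule has_vector_derivative_of_real)
    then show "(k has_vector_derivative - complex_of_real (cos \<theta>) * k \<theta> * k \<theta>) (at \<theta>)"
      by (simp add: k_def[abs_def])
    define t where "t \<theta> = (1 + cos \<theta>) / (1 - cos \<theta>)" for \<theta> :: real
    have t: "t \<theta> > 0" using c by (simp add: t_def)
    have "(t has_real_derivative - 2 * sin \<theta> / (1 - cos \<theta>)\<^sup>2) (at \<theta>)"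
      unfolding t_def[abs_def] using c
      by (auto intro!: derivative_eq_intros simp: power2_eq_square) (simp add: algebra_simps)
    \<comment> \<open>With the derivative of t a multiple of t, the exponent lowered by
      \<open>powr\<close> differentiation is restored and q reappears.\<close>
    moreover have "- 2 * sin \<theta> / (1 - cos \<theta>)\<^sup>2 = - 2 * inverse (sin \<theta>) * t \<theta>"
    proof -
      have "sin \<theta> * sin \<theta> = (1 - cos \<theta>) * (1 + cos \<theta>)"
        using sin_cos_squared_add[of \<theta>] by (simp add: power2_eq_square algebra_simps)
      then have "t \<theta> = sin \<theta> * sin \<theta> / (1 - cos \<theta>)\<^sup>2"
        using c by (simp add: t_def power2_eq_square)
      then show ?thesis
        using s by simp
    qed
    ultimately have dt: "((\<lambda>\<theta>. complex_of_real (t \<theta>)) has_vector_derivative of_real (- 2 * inverse (sin \<theta>) * t \<theta>)) (at \<theta>)"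
      by (intro has_vector_derivative_of_real) simp
    have "((\<lambda>z. z powr (\<mu> / 2)) has_field_derivative \<mu> / 2 * of_real (t \<theta>) powr (\<mu> / 2 - 1)) (at (of_real (t \<theta>)))"
      using t by (intro has_field_derivative_powr) auto
    from field_vector_diff_chain_at[OF dt this]
    have "(q has_vector_derivative of_real (- 2 * inverse (sin \<theta>) * t \<theta>) * (\<mu> / 2 * of_real (t \<theta>) powr (\<mu> / 2 - 1))) (at \<theta>)"
      by (simp add: o_def q_def[abs_def] t_def)
    moreover have "of_real (- 2 * inverse (sin \<theta>) * t \<theta>) * (\<mu> / 2 * of_real (t \<theta>) powr (\<mu> / 2 - 1)) = - \<mu> * k \<theta> * q \<theta>"
      using t by (simp add: powr_diff k_def q_def t_def[symmetric] flip: t_def)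
    ultimately show "(q has_vector_derivative - \<mu> * k \<theta> * q \<theta>) (at \<theta>)"
      by (simp only:)
  qed
  have "associated_Legendre \<nu> \<mu> (\<lambda>\<theta>. ferrersP \<nu> \<mu> (cos \<theta>)) g' g''"
  proof
    fix \<theta> :: real
    assume \<theta>: "0 < \<theta>" "\<theta> < pi"
    note d = dh[OF \<theta>] dh'[OF \<theta>] dq[OF \<theta>] dk[OF \<theta>]
    have "((\<lambda>\<theta>. q \<theta> * h \<theta>) has_vector_derivative g' \<theta>) (at \<theta>)"
      using has_vector_derivative_mult[OF d(3) d(1)] by (simp add: g'_def algebra_simps)
    then show "((\<lambda>\<theta>. ferrersP \<nu> \<mu> (cos \<theta>)) has_vector_derivative g' \<theta>) (at \<theta>)"
      by (rule has_vector_derivative_transform_within_open[where S = "{0<..<pi}"]) (use \<theta> g in auto)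
    have "((\<lambda>\<theta>. q \<theta> * (h' \<theta> - \<mu> * (k \<theta> * h \<theta>))) has_vector_derivative
       q \<theta> * (h'' \<theta> - \<mu> * (k \<theta> * h' \<theta> + (- complex_of_real (cos \<theta>) * k \<theta> * k \<theta>) * h \<theta>)) + (- \<mu> * k \<theta> * q \<theta>) * (h' \<theta> - \<mu> * (k \<theta> * h \<theta>))) (at \<theta>)"
      by (intro has_vector_derivative_mult has_vector_derivative_diff has_vector_derivative_mult_right d)
    then show "(g' has_vector_derivative g'' \<theta>) (at \<theta>)"
      by (simp add: g'_def[abs_def] g''_def algebra_simps)
    define s c where "s = complex_of_real (sin \<theta>)" and "c = complex_of_real (cos \<theta>)"
    have k: "k \<theta> = inverse s" "s \<noteq> 0"
      using s[OF \<theta>] by (simp_all add: k_def s_def)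
    have cs: "x \<theta> * (1 - x \<theta>) = s * s / 4" "x \<theta> = (1 - c) / 2"
    proof -
      show "x \<theta> = (1 - c) / 2"
        by (simp add: x_def c_def)
      have "s * s = 1 - c * c"
        unfolding s_def c_def by (metis of_real_1 of_real_diff of_real_mult power2_eq_square sin_squared_eq)
      then show "x \<theta> * (1 - x \<theta>) = s * s / 4"
        unfolding \<open>x \<theta> = (1 - c) / 2\<close> by (simp only:) (simp add: field_simps)
    qed
    \<comment> \<open>The hypergeometric equation at x: its first-order coefficient 1 - \<mu> - 2 x
      equals c - \<mu>.\<close>
    have "s * s / 4 * F'' (x \<theta>) = (\<mu> - c) * F' (x \<theta>) - \<nu> * (\<nu> + 1) * h \<theta>"
      using F(3)[OF x[OF \<theta>]] unfolding cs(1) by (simp add: h_def cs(2) field_simps)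
    moreover have "h'' \<theta> = s * s / 4 * F'' (x \<theta>) + c / 2 * F' (x \<theta>)"
      by (simp add: h''_def mult_ac flip: s_def c_def)
    ultimately have h'': "h'' \<theta> = (\<mu> - c / 2) * F' (x \<theta>) - \<nu> * (\<nu> + 1) * h \<theta>"
      by (simp only:) (simp add: field_simps)
    have h': "k \<theta> * h' \<theta> = F' (x \<theta>) / 2"
      using k by (simp add: h'_def flip: s_def)
    \<comment> \<open>The terms in k^2 cancel, so the singular part disappears and only the equation
      for h is left.\<close>
    have "g'' \<theta> + c * k \<theta> * g' \<theta> + (\<nu> * (\<nu> + 1) - \<mu> * \<mu> * k \<theta> * k \<theta>) * (q \<theta> * h \<theta>) =
      q \<theta> * (h'' \<theta> + (c - 2 * \<mu>) * (k \<theta> * h' \<theta>) + \<nu> * (\<nu> + 1) * h \<theta>)"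
      by (simp add: g''_def g'_def algebra_simps flip: c_def)
    also have "\<dots> = 0"
      unfolding h' h'' by (simp add: field_simps)
    finally show "g'' \<theta> = - complex_of_real (cos \<theta>) * inverse (complex_of_real (sin \<theta>)) * g' \<theta>
      - (\<nu> * (\<nu> + 1) - \<mu> * \<mu> * inverse (complex_of_real (sin \<theta>)) * inverse (complex_of_real (sin \<theta>))) * ferrersP \<nu> \<mu> (cos \<theta>)"
      unfolding g[OF \<theta>] k(1) c_def s_def by (simp add: algebra_simps add_eq_0_iff)
  qed
  then show thesis
    by (rule that)
qed

theorem theorem9p6:
  fixes \<nu>0 \<mu>0 :: complex and L :: realization
  shows "(\<forall>f \<in> harmonic_span \<nu>0 \<mu>0. \<forall>p \<in> solid_domain.
            casimir2 L diff_op f p = (- 5/4) * f p \<and> casimir4 L diff_op f p = 0)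
       \<and> (\<forall>v :: int \<times> int \<Rightarrow> complex. finite {i. v i \<noteq> 0} \<longrightarrow>
            casimir2 L (matrix_op \<nu>0 \<mu>0) v = (\<lambda>i. (- 5/4) * v i) \<and>
            casimir4 L (matrix_op \<nu>0 \<mu>0) v = (\<lambda>i. 0))"
proof (intro conjI ballI allI impI)
  interpret diff: local_representation diff_op solid_domain partially_differentiable
    by (rule local_representation_diff_op)
  interpret fun_space: module "\<lambda>(c::complex) (f :: point \<Rightarrow> complex) p. c * f p"
    by unfold_locales (auto simp: algebra_simps)
  fix f p
  assume f: "f \<in> harmonic_span \<nu>0 \<mu>0" and p: "p \<in> solid_domain"
  \<comment> \<open>Membership in \<open>D2\<close> accompanies the relations through the induction,
    because combining the relations of two functions uses it.\<close>
  have harmonic: "f \<in> diff.D2 \<and> (\<forall>q \<in> solid_domain. diff.singleton_relations f q)"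
    using f unfolding harmonic_span_def
  proof (induction rule: fun_space.span_induct_alt)
    case base
    then show ?case
      using diff.D2_zero diff.singleton_relations_zero by (simp add: zero_fun_def)
  next
    case (step c x y)
    then obtain \<nu> \<mu> where "x = solid_harmonic \<nu> \<mu>"
      by auto
    moreover obtain g' g'' where "associated_Legendre \<nu> \<mu> (\<lambda>\<theta>. ferrersP \<nu> \<mu> (cos \<theta>)) g' g''"
      by (rule associated_Legendre_ferrersP)
    ultimately have "x \<in> diff.D2" "\<forall>q \<in> solid_domain. diff.singleton_relations x q"
      using associated_Legendre.separated_in_D2 associated_Legendre.singleton_relations_separated
      by (auto simp: solid_harmonic_eq_separated)
    with step show ?case
      using diff.D2_combination(1) diff.singleton_relations_combination by blast
  qed
  then show "casimir2 L diff_op f p = (- 5/4) * f p" "casimir4 L diff_op f p = 0"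
    using p diff.casimir2_eq diff.casimir4_eq_0 by blast+
next
  interpret matrix: local_representation "matrix_op \<nu>0 \<mu>0" UNIV UNIV
    by (rule local_representation_matrix_op)
  fix v :: "int \<times> int \<Rightarrow> complex"
  have v: "v \<in> matrix.D2"
    by (simp add: matrix.D2_def)
  show "casimir2 L (matrix_op \<nu>0 \<mu>0) v = (\<lambda>i. (- 5/4) * v i)"
    using matrix.casimir2_eq[OF v UNIV_I singleton_relations_matrix_op] by (intro ext)
  show "casimir4 L (matrix_op \<nu>0 \<mu>0) v = (\<lambda>i. 0)"
    using matrix.casimir4_eq_0[OF v singleton_relations_matrix_op UNIV_I] by (intro ext)
qed

end
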